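(* Let $n\ge 1$, let $S$ be a real-analytic function, not identically zero, on a neighborhood $U$ of the origin in $\mathbb{R}^n$ with $S(0)=0$ and $\nabla S(0)=0$. Let the variables $t_1,\dots,t_n$ be split into groups $\mathbf{t}=(\mathbf{t}_1,\dots,\mathbf{t}_m)$ with $\mathbf{t}_i=(t_{i1},\dots,t_{il_i})$ (so $l_i\ge 1$ and $l_1+\dots+l_m=n$), and let $0\le \alpha_i<l_i$ for $i=1,\dots,m$. Let $K$ be a function with compact support contained in $U$ that is $C^1$ on $\{\mathbf{t}\in U: t_i\ne 0 \text{ for all } i\}$ and satisfies there, for some $C>0$, $$|K(\mathbf{t})|\le C\prod_{k=1}^m|\mathbf{t}_k|^{-\alpha_k},\qquad |\partial_{t_{ij}}K(\mathbf{t})|\le C\frac{1}{|t_{ij}|}\prod_{k=1}^m|\mathbf{t}_k|^{-\alpha_k}\quad\text{for all } i,j.$$ Let $T$ be the operator $$Tf(\mathbf{x},x_{n+1})=\int_{\mathbb{R}^n}f(\mathbf{x}-\mathbf{t},x_{n+1}-S(\mathbf{t}))\,K(\mathbf{t})\,d\mathbf{t},\qquad \mathbf{x}\in\mathbb{R}^n,\ x_{n+1}\in\mathbb{R}.$$ Then for any $1<p<q<\infty$ and any $\gamma>1+\sum_{i=1}^m\alpha_i$, the operator $T$ is bounded from $L^p(\mathbb{R}^{n+1})$ to $L^q_{-\gamma}(\mathbb{R}^{n+1})$.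
   Context: For $1<q<\infty$ and $s\in\mathbb{R}$ (positive, negative or zero), $L^q_s(\mathbb{R}^{n+1})$ is the Sobolev (Bessel potential) space with norm $\|f\|_{L^q_s}=\|(I-\Delta)^{s/2}f\|_{L^q}$, where $(I-\Delta)^{s/2}$ is the Fourier multiplier operator with multiplier $(1+|\xi|^2)^{s/2}$. "$T$ is bounded from $L^p$ to $L^q_s$" means that there is a constant $C'$ with $\|Tf\|_{L^q_s}\le C'\|f\|_{L^p}$ for all Schwartz functions $f$ (so that $T$ extends to a bounded operator). Here $|\mathbf{t}_k|$ is the Euclidean norm of $\mathbf{t}_k\in\mathbb{R}^{l_k}$. *)

theory Defs
  imports "HOL-Analysis.Analysis"
begin

definition partial_deriv ::
    "'a::euclidean_space \<Rightarrow> ('a \<Rightarrow> 'b::real_normed_vector) \<Rightarrow> 'a \<Rightarrow> 'b" where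
  "partial_deriv b f x = frechet_derivative f (at x) b"

text \<open>Meant for open \<open>\<Omega>\<close>, as it refers to full neighbourhoods of the points of \<open>\<Omega>\<close>.\<close>

definition C1_on :: "'a set \<Rightarrow> ('a::euclidean_space \<Rightarrow> 'b::real_normed_vector) \<Rightarrow> bool" where
  "C1_on \<Omega> f \<longleftrightarrow> (\<forall>x\<in>\<Omega>. f differentiable (at x)) \<and>
     (\<forall>b\<in>Basis. continuous_on \<Omega> (partial_deriv b f))"

text \<open>
  \<open>partial_derivs bs\<close> is the iterated partial derivative along the list \<open>bs\<close> of directions.
  Lists of basis vectors take the place of multi-indices.
\<close>

definition partial_derivs ::
    "'a::euclidean_space list \<Rightarrow> ('a \<Rightarrow> 'b::real_normed_vector) \<Rightarrow> 'a \<Rightarrow> 'b" where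
  "partial_derivs bs f = foldr partial_deriv bs f"

definition schwartz :: "('a::euclidean_space \<Rightarrow> complex) \<Rightarrow> bool" where
  "schwartz f \<longleftrightarrow>
     (\<forall>bs. set bs \<subseteq> Basis \<longrightarrow>
        (\<forall>x. partial_derivs bs f differentiable (at x)) \<and>
        (\<forall>N::nat. \<exists>B. \<forall>x. (1 + norm x) ^ N * norm (partial_derivs bs f x) \<le> B))"

text \<open>
  Around every point of \<open>U\<close>, \<open>S\<close> is the sum of a multivariate power series; multi-indices are
  functions \<open>'n \<Rightarrow> nat\<close>, and the unordered real sums converge absolutely.
\<close>

definition real_analytic_on :: "(real ^ 'n \<Rightarrow> real) \<Rightarrow> (real ^ 'n) set \<Rightarrow> bool" where
  "real_analytic_on S U \<longleftrightarrow>
     (\<forall>a\<in>U. \<exists>r>0. \<exists>c :: ('n \<Rightarrow> nat) \<Rightarrow> real. \<forall>x.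
        (\<forall>i. \<bar>x $ i - a $ i\<bar> < r) \<longrightarrow>
        ((\<lambda>k. c k * (\<Prod>i\<in>UNIV. (x $ i - a $ i) ^ k i)) has_sum S x) UNIV)"

definition Lp_norm :: "real \<Rightarrow> ('a::euclidean_space \<Rightarrow> complex) \<Rightarrow> ennreal" where
  "Lp_norm p f =
     (let I = (\<integral>\<^sup>+ x. ennreal (norm (f x) powr p) \<partial>lebesgue)
      in if I = \<infinity> then \<infinity> else ennreal (enn2real I powr (1 / p)))"

text \<open>
  Normalization: with the kernel \<open>exp (- \<i> x \<bullet> \<xi>)\<close> the operator \<open>I - \<Delta>\<close> has multiplier
  \<open>1 + |\<xi>|\<^sup>2\<close>, without factors of \<open>2\<pi>\<close>.
\<close>

definition fourier :: "('a::euclidean_space \<Rightarrow> complex) \<Rightarrow> 'a \<Rightarrow> complex" where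
  "fourier g \<xi> = (LINT x|lebesgue. cis (- (x \<bullet> \<xi>)) * g x)"

definition inv_fourier :: "('a::euclidean_space \<Rightarrow> complex) \<Rightarrow> 'a \<Rightarrow> complex" where
  "inv_fourier h x =
     complex_of_real (1 / (2 * pi) ^ DIM('a)) * (LINT \<xi>|lebesgue. cis (x \<bullet> \<xi>) * h \<xi>)"

definition fourier_multiplier ::
    "('a \<Rightarrow> real) \<Rightarrow> ('a::euclidean_space \<Rightarrow> complex) \<Rightarrow> 'a \<Rightarrow> complex" where
  "fourier_multiplier m g = inv_fourier (\<lambda>\<xi>. complex_of_real (m \<xi>) * fourier g \<xi>)"

definition bessel_symbol :: "real \<Rightarrow> 'a::euclidean_space \<Rightarrow> real" where
  "bessel_symbol s \<xi> = (1 + (norm \<xi>)\<^sup>2) powr (s / 2)"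

text \<open>
  The norm of \<open>L\<^sup>q\<^sub>s\<close> on those functions for which the Fourier integrals defining
  \<open>(I - \<Delta>)\<^bsup>s/2\<^esup> g\<close> converge absolutely; this includes all Schwartz functions, for every real \<open>s\<close>.
  The Bochner integral of a non-integrable function is 0, so outside of this domain the value
  is set to \<open>\<infinity>\<close>: a finite bound on \<open>sobolev_norm q s g\<close> never comes from a divergent integral.
\<close>

definition sobolev_norm ::
    "real \<Rightarrow> real \<Rightarrow> ('a::euclidean_space \<Rightarrow> complex) \<Rightarrow> ennreal" where
  "sobolev_norm q s g =
     (if integrable lebesgue g \<and>
         integrable lebesgue (\<lambda>\<xi>. complex_of_real (bessel_symbol s \<xi>) * fourier g \<xi>)
      then Lp_norm q (fourier_multiplier (bessel_symbol s) g) else \<infinity>)"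

definition bounded_Lp_sobolev ::
    "(('a::euclidean_space \<Rightarrow> complex) \<Rightarrow> 'a \<Rightarrow> complex) \<Rightarrow> real \<Rightarrow> real \<Rightarrow> real \<Rightarrow> bool" where
  "bounded_Lp_sobolev T p q s \<longleftrightarrow>
     (\<exists>C'\<ge>0. \<forall>f. schwartz f \<longrightarrow> sobolev_norm q s (T f) \<le> ennreal C' * Lp_norm p f)"

text \<open>
  A splitting of the coordinates into groups \<open>1, \<dots>, m\<close> is a map \<open>grp\<close> from coordinates to group
  numbers; \<open>group_norm grp k t\<close> is the Euclidean norm of the block of \<open>t\<close> in group \<open>k\<close>.
\<close>

definition group_norm :: "('n::finite \<Rightarrow> nat) \<Rightarrow> nat \<Rightarrow> real ^ 'n \<Rightarrow> real" where
  "group_norm grp k t = L2_set (\<lambda>j. t $ j) {j. grp j = k}"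

text \<open>\<open>\<real>\<^bsup>n+1\<^esup>\<close> is \<open>(real ^ 'n) \<times> real\<close> with its Euclidean product structure.\<close>

definition surface_conv ::
    "(real ^ 'n \<Rightarrow> real) \<Rightarrow> (real ^ 'n \<Rightarrow> complex) \<Rightarrow>
     ((real ^ 'n) \<times> real \<Rightarrow> complex) \<Rightarrow> (real ^ 'n) \<times> real \<Rightarrow> complex" where
  "surface_conv S K f = (\<lambda>(x, y). LINT t|lebesgue. f (x - t, y - S t) * K t)"

end

theory Submission
  imports Defs "HOL-Probability.Probability"
begin

text \<open>
  The operator is convolution with the complex measure \<open>\<mu>\<close> that puts the density \<open>K\<close> on the graph
  of \<open>S\<close>, so \<open>(I - \<Delta>)\<^bsup>-\<gamma>/2\<^esup> T\<close> is convolution with \<open>G * \<mu>\<close>, where \<open>G\<close> is the Bessel kernel of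
  order \<open>\<gamma>\<close>. If \<open>G * \<bar>\<mu>\<bar>\<close> is both integrable and bounded, then it maps \<open>L\<^sup>p\<close> to \<open>L\<^sup>q\<close> for all
  \<open>1 < p < q\<close> (\<open>convolution_Lp_Lq_bound\<close>). Integrability holds because \<open>\<mu>\<close> has finite mass and
  \<open>G\<close> has integral 1; boundedness is where the lower bound on \<open>\<gamma>\<close> enters.

  To estimate \<open>G * \<bar>\<mu>\<bar>\<close>, subordinate the Bessel kernel to the heat kernels \<open>h\<^sub>s\<close>. The Gamma integral
  \<open>(1 + |\<xi>|\<^sup>2)\<^bsup>-\<gamma>/2\<^esup> = 1/\<Gamma>(\<gamma>/2) \<integral> s\<^bsup>\<gamma>/2 - 1\<^esup> e\<^bsup>-s\<^esup> e\<^bsup>-s|\<xi>|\<^sup>2\<^esup> ds\<close> exhibits \<open>G\<close> as the corresponding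
  average of the \<open>h\<^sub>s\<close> (\<open>bessel_potential_bound\<close>). So a bound
  \<open>h\<^sub>s * \<bar>\<mu>\<bar> \<le> A s\<^bsup>-\<delta>/2\<^esup>\<close> for some \<open>\<delta> < \<gamma>\<close> gives \<open>G * \<bar>\<mu>\<bar> \<le> A \<Gamma>((\<gamma> - \<delta>)/2) / \<Gamma>(\<gamma>/2)\<close>. This reduces
  the problem to a heat kernel bound, in \<open>bounded_Lp_sobolev_of_heat_bound\<close>.

  For the graph measure the bound holds with \<open>\<delta> = 1 + \<Sum>\<alpha>\<^sub>k\<close>. The heat kernel of \<open>\<real>\<^bsup>n+1\<^esup>\<close> at a difference
  of points is at most \<open>(4\<pi>s)\<^bsup>-(n+1)/2\<^esup>\<close> times a Gaussian in the \<open>n\<close> base variables. The norm of a block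
  dominates the modulus of each of its coordinates, so
  \<open>|t\<^sub>k|\<^bsup>-\<alpha>\<^sub>k\<^esup> \<le> \<Prod> |t\<^sub>k\<^sub>j|\<^bsup>-\<alpha>\<^sub>k/l\<^sub>k\<^esup>\<close>: the singularity splits into one-dimensional ones with
  exponents \<open>\<beta> = \<alpha>\<^sub>k/l\<^sub>k < 1\<close>. Each coordinate then contributes
  \<open>\<integral> |t|\<^bsup>-\<beta>\<^esup> e\<^bsup>-(z - t)\<^sup>2/4s\<^esup> dt \<le> c s\<^bsup>(1 - \<beta>)/2\<^esup>\<close> uniformly in \<open>z\<close>, and the powers of \<open>s\<close>
  multiply up to \<open>s\<^bsup>-(1 + \<Sum>\<alpha>\<^sub>k)/2\<^esup>\<close>.

  The Sobolev norm is defined by absolutely convergent Fourier integrals, so the argument also needs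
  that Fourier transforms of Schwartz functions are integrable.
\<close>

section \<open>Integrals over Euclidean space\<close>

text \<open>
  The complex-valued counterpart of \<open>nn_integral_lborel_prod\<close>; the oscillating factors of a Fourier
  integral rule out the nonnegative version.
\<close>

lemma has_bochner_integral_lborel_prod:
  fixes f :: "'a::euclidean_space \<Rightarrow> real \<Rightarrow> complex"
  assumes int: "\<And>b. b \<in> Basis \<Longrightarrow> integrable lborel (f b)"
  shows "has_bochner_integral lborel (\<lambda>x::'a. \<Prod>b\<in>Basis. f b (x \<bullet> b))
           (\<Prod>b\<in>Basis. (LINT x|lborel. f b x))"
proof -
  interpret product_sigma_finite "\<lambda>_::'a. lborel :: real measure" ..
  have [measurable]: "f b \<in> borel_measurable borel" if "b \<in> Basis" for b
    using int[OF that] by (simp add: integrable_iff_bounded)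
  have "integrable lborel (\<lambda>x::'a. \<Prod>b\<in>Basis. f b (x \<bullet> b))"
    by (subst lborel_eq, subst integrable_distr_eq)
      (auto simp: product_integrable_prod int cong: prod.cong)
  moreover have "(LINT x|lborel. (\<Prod>b\<in>Basis. f b ((x::'a) \<bullet> b))) = (\<Prod>b\<in>Basis. (LINT x|lborel. f b x))"
    by (subst lborel_eq, subst integral_distr)
      (auto simp: product_integral_prod int cong: prod.cong)
  ultimately show ?thesis by (simp add: has_bochner_integral_iff)
qed

lemma lborel_distr_reflect: "distr lborel borel (\<lambda>x. a - x) = (lborel :: 'a::euclidean_space measure)"
  using lborel_affine[of "-1" a] by (simp add: density_1)

lemma nn_integral_lborel_translate:
  fixes a :: "'a::euclidean_space"
  assumes [measurable]: "f \<in> borel_measurable borel"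
  shows "(\<integral>\<^sup>+x. f (x + a) \<partial>lborel) = (\<integral>\<^sup>+x. f x \<partial>lborel)"
  by (subst (2) lborel_distr_plus[of a, symmetric])
    (simp add: nn_integral_distr add.commute)

lemma nn_integral_lborel_reflect:
  fixes a :: "'a::euclidean_space"
  assumes [measurable]: "f \<in> borel_measurable borel"
  shows "(\<integral>\<^sup>+x. f (a - x) \<partial>lborel) = (\<integral>\<^sup>+x. f x \<partial>lborel)"
  by (subst (2) lborel_distr_reflect[of a, symmetric]) (simp add: nn_integral_distr)

lemma integral_lborel_translate:
  fixes a :: "'a::euclidean_space" and f :: "'a \<Rightarrow> complex"
  assumes [measurable]: "f \<in> borel_measurable borel"
  shows "(LINT x|lborel. f (x + a)) = (LINT x|lborel. f x)"
  by (subst (2) lborel_distr_plus[of a, symmetric])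
    (simp add: integral_distr add.commute)

lemma integrable_lborel_translate:
  fixes a :: "'a::euclidean_space" and f :: "'a \<Rightarrow> complex"
  assumes "integrable lborel f"
  shows "integrable lborel (\<lambda>x. f (x + a))"
proof -
  have [measurable]: "f \<in> borel_measurable borel"
    using assms by (simp add: integrable_iff_bounded)
  have "integrable (distr lborel borel (\<lambda>x. a + x)) f"
    using assms by (simp add: lborel_distr_plus)
  then show ?thesis by (simp add: integrable_distr_eq add.commute)
qed

section \<open>The heat kernel\<close>

text \<open>
  The fundamental solution of \<open>\<partial>\<^sub>s h = \<Delta> h\<close>, whose Fourier transform is \<open>e\<^bsup>-s|\<xi>|\<^sup>2\<^esup>\<close>.
\<close>

definition heat_kernel :: "real \<Rightarrow> 'a::euclidean_space \<Rightarrow> real" where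
  "heat_kernel s x = exp (- (norm x)\<^sup>2 / (4 * s)) / sqrt (4 * pi * s) ^ DIM('a)"

lemma heat_kernel_nonneg [simp]: "s > 0 \<Longrightarrow> 0 \<le> heat_kernel s x"
  by (simp add: heat_kernel_def)

lemma heat_kernel_measurable [measurable]:
  "(\<lambda>(s, x). heat_kernel s x) \<in> borel_measurable (borel \<Otimes>\<^sub>M borel)"
  unfolding heat_kernel_def by measurable

lemma exp_norm_sq_eq_prod:
  "exp (c * (norm (x::'a::euclidean_space))\<^sup>2) = (\<Prod>b\<in>Basis. exp (c * (x \<bullet> b)\<^sup>2))"
proof -
  have "(norm x)\<^sup>2 = (\<Sum>b\<in>Basis. (x \<bullet> b)\<^sup>2)"
    unfolding power2_norm_eq_inner euclidean_inner[of x x] by (simp add: power2_eq_square)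
  then show ?thesis by (simp add: exp_sum[symmetric] sum_distrib_left[symmetric])
qed

lemma cis_inner_eq_prod:
  "cis ((w::'a::euclidean_space) \<bullet> x) = (\<Prod>b\<in>Basis. cis ((w \<bullet> b) * (x \<bullet> b)))"
  by (simp add: euclidean_inner[of w x] cis_conv_exp exp_sum[symmetric] sum_distrib_left)

text \<open>
  Rescaling by \<open>1 / sqrt (2 s)\<close> turns this into the characteristic function of the standard normal
  distribution.
\<close>

lemma gaussian_fourier_1dim:
  fixes s w :: real
  assumes "s > 0"
  shows "has_bochner_integral lborel (\<lambda>x. cis (w * x) * complex_of_real (exp (- s * x\<^sup>2)))
           (complex_of_real (2 * pi * (exp (- w\<^sup>2 / (4 * s)) / sqrt (4 * pi * s))))"
proof -
  define c where "c = 1 / sqrt (2 * s)"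
  define g where "g x = cis (w * x) * complex_of_real (exp (- s * x\<^sup>2))" for x
  have c: "c > 0" "c\<^sup>2 = 1 / (2 * s)" using assms by (auto simp: c_def power_divide)
  have [measurable]: "g \<in> borel_measurable borel"
    unfolding g_def cis_conv_exp by measurable
  have scale: "g (0 + c * x) = sqrt (2 * pi) * (std_normal_density x *\<^sub>R iexp (w * c * x))" for x
  proof -
    have "s * (c * x)\<^sup>2 = x\<^sup>2 / 2"
      using assms by (simp add: power_mult_distrib c)
    then show ?thesis
      by (simp add: g_def std_normal_density_def cis_conv_exp scaleR_conv_of_real mult_ac)
  qed
  have "integrable lborel (\<lambda>x. std_normal_density x *\<^sub>R iexp (w * c * x))"
    by (rule Bochner_Integration.integrable_bound[OF integrable_normal_density[of 1 0]])
      (auto simp: norm_mult)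
  moreover have "(LINT x|lborel. std_normal_density x *\<^sub>R iexp (w * c * x)) = exp (- ((w * c)\<^sup>2) / 2)"
    using fun_cong[OF char_std_normal_distribution, of "w * c"]
    unfolding char_def by (subst (asm) integral_density) (auto simp: normal_density_nonneg)
  ultimately have "has_bochner_integral lborel (\<lambda>x. std_normal_density x *\<^sub>R iexp (w * c * x))
      (complex_of_real (exp (- ((w * c)\<^sup>2) / 2)))"
    by (simp add: has_bochner_integral_iff)
  then have "has_bochner_integral lborel (\<lambda>x. g (0 + c * x))
      (complex_of_real (sqrt (2 * pi)) * (complex_of_real (exp (- ((w * c)\<^sup>2) / 2))))"
    unfolding scale by (rule has_bochner_integral_mult_right)
  also have "complex_of_real (sqrt (2 * pi)) * (complex_of_real (exp (- ((w * c)\<^sup>2) / 2)))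
     = complex_of_real (2 * pi * (exp (- w\<^sup>2 / (4 * s)) / sqrt (4 * pi * s))) /\<^sub>R \<bar>c\<bar>"
  proof -
    have "sqrt (2 * pi) * c = 2 * pi / sqrt (4 * pi * s)"
      using assms by (simp add: c_def real_sqrt_mult field_simps)
    then have "sqrt (2 * pi) = 2 * pi / sqrt (4 * pi * s) / c"
      using c by (metis nonzero_mult_div_cancel_right less_irrefl)
    moreover have "(w * c)\<^sup>2 / 2 = w\<^sup>2 / (4 * s)" by (simp add: power_mult_distrib c)
    ultimately have "sqrt (2 * pi) * exp (- ((w * c)\<^sup>2) / 2)
         = 2 * pi * (exp (- w\<^sup>2 / (4 * s)) / sqrt (4 * pi * s)) / c"
      by simp
    then show ?thesis using c
      by (simp only: scaleR_conv_of_real of_real_mult[symmetric]) (simp add: field_simps)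
  qed
  finally show ?thesis
    using c lborel_has_bochner_integral_real_affine_iff[of c g _ 0]
    by (auto simp: g_def[abs_def])
qed

text \<open>
  Gaussian and character both factor over the coordinates, so this is a product of one-dimensional
  integrals. In terms of the Fourier transform: the inverse transform of \<open>e\<^bsup>-s|\<xi>|\<^sup>2\<^esup>\<close> is the heat kernel.
\<close>

lemma gaussian_fourier:
  fixes w :: "'a::euclidean_space"
  assumes "s > 0"
  shows "has_bochner_integral lborel (\<lambda>\<xi>. cis (w \<bullet> \<xi>) * complex_of_real (exp (- s * (norm \<xi>)\<^sup>2)))
           (complex_of_real ((2 * pi) ^ DIM('a) * heat_kernel s w))"
proof -
  let ?f = "\<lambda>b x. cis ((w \<bullet> b) * x) * complex_of_real (exp (- s * x\<^sup>2))"
  note G = gaussian_fourier_1dim[OF assms, unfolded has_bochner_integral_iff]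
  have "has_bochner_integral lborel (\<lambda>x::'a. \<Prod>b\<in>Basis. ?f b (x \<bullet> b))
      (\<Prod>b\<in>Basis. (LINT x|lborel. ?f b x))"
    using G by (intro has_bochner_integral_lborel_prod) auto
  also have "(\<lambda>x::'a. \<Prod>b\<in>Basis. ?f b (x \<bullet> b)) =
     (\<lambda>\<xi>. cis (w \<bullet> \<xi>) * complex_of_real (exp (- s * (norm \<xi>)\<^sup>2)))"
    unfolding exp_norm_sq_eq_prod cis_inner_eq_prod by (simp add: prod.distrib)
  also have "(\<Prod>b\<in>Basis. (LINT x|lborel. ?f b x)) =
     complex_of_real (\<Prod>b\<in>Basis. 2 * pi * (exp (- (1 / (4 * s)) * (w \<bullet> b)\<^sup>2) / sqrt (4 * pi * s)))"
    using G by simp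
  also have "(\<Prod>b\<in>Basis. 2 * pi * (exp (- (1 / (4 * s)) * (w \<bullet> b)\<^sup>2) / sqrt (4 * pi * s)))
     = (2 * pi) ^ DIM('a) * heat_kernel s w"
    unfolding heat_kernel_def prod.distrib prod_dividef exp_norm_sq_eq_prod[symmetric] by simp
  finally show ?thesis .
qed

lemma nn_integral_gaussian:
  assumes "s > 0"
  shows "(\<integral>\<^sup>+x. ennreal (exp (- s * (norm (x::'a::euclidean_space))\<^sup>2)) \<partial>lborel) =
    ennreal (sqrt (pi / s) ^ DIM('a))"
proof -
  have "has_bochner_integral lborel (\<lambda>\<xi>::'a. complex_of_real (exp (- s * (norm \<xi>)\<^sup>2)))
     (complex_of_real ((2 * pi / sqrt (4 * pi * s)) ^ DIM('a)))"
    using gaussian_fourier[OF assms, where 'a='a and w=0]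
    by (simp add: heat_kernel_def power_divide)
  also have "2 * pi / sqrt (4 * pi * s) = sqrt (pi / s)"
    using assms by (simp add: real_sqrt_mult real_sqrt_divide field_simps)
  finally have "has_bochner_integral lborel (\<lambda>\<xi>::'a. (exp (- s * (norm \<xi>)\<^sup>2)))
     (sqrt (pi / s) ^ DIM('a))"
    unfolding has_bochner_integral_iff of_real_power[symmetric]
    by (simp del: of_real_power add: complex_of_real_integrable_eq)
  then show ?thesis by (auto simp: has_bochner_integral_iff nn_integral_eq_integral complex_of_real_integrable_eq)
qed

lemma nn_integral_heat_kernel:
  assumes "s > 0"
  shows "(\<integral>\<^sup>+x. ennreal (heat_kernel s (x::'a::euclidean_space)) \<partial>lborel) = 1"
proof -
  have "(\<integral>\<^sup>+x. ennreal (heat_kernel s (x::'a)) \<partial>lborel) =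
     (\<integral>\<^sup>+x. ennreal (exp (- (1 / (4 * s)) * (norm (x::'a))\<^sup>2)) \<partial>lborel) / ennreal (sqrt (4 * pi * s) ^ DIM('a))"
    using assms by (subst nn_integral_divide[symmetric]) (auto simp: heat_kernel_def divide_ennreal)
  also have "\<dots> = 1"
    using assms by (subst nn_integral_gaussian) (auto simp: divide_ennreal mult_ac)
  finally show ?thesis .
qed

section \<open>Schwartz functions and their Fourier transforms\<close>

lemma fourier_eq_lborel:
  assumes [measurable]: "g \<in> borel_measurable borel"
  shows "fourier g \<xi> = (LINT x|lborel. cis (- (x \<bullet> \<xi>)) * g x)"
  unfolding fourier_def cis_conv_exp by (rule integral_completion) measurable

lemma norm_fourier_le:
  assumes "integrable lborel g"
  shows "norm (fourier g \<xi>) \<le> (LINT x|lborel. norm (g x))"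
proof -
  have "norm (fourier g \<xi>) \<le> (LINT x|lborel. norm (cis (- (x \<bullet> \<xi>)) * g x))"
    using assms by (subst fourier_eq_lborel) (auto simp: integrable_iff_bounded intro: integral_norm_bound)
  then show ?thesis by (simp add: norm_mult)
qed

lemma fourier_measurable:
  assumes [measurable]: "g \<in> borel_measurable borel"
  shows "fourier g \<in> borel_measurable borel"
proof -
  have "(\<lambda>\<xi>. LINT x|lborel. cis (- (x \<bullet> \<xi>)) * g x) \<in> borel_measurable borel"
    unfolding cis_conv_exp by measurable
  moreover have "fourier g = (\<lambda>\<xi>. LINT x|lborel. cis (- (x \<bullet> \<xi>)) * g x)"
    by (simp add: fun_eq_iff fourier_eq_lborel)
  ultimately show ?thesis by simp
qed

lemma integrable_cis_mult:
  fixes g :: "'a::euclidean_space \<Rightarrow> complex"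
  assumes "integrable lborel g" and [measurable]: "a \<in> borel_measurable borel"
  shows "integrable lborel (\<lambda>x. cis (a x) * g x)"
proof -
  have [measurable]: "g \<in> borel_measurable borel" using assms by (simp add: integrable_iff_bounded)
  show ?thesis
    by (rule Bochner_Integration.integrable_bound[OF assms(1)]) (auto simp: norm_mult cis_conv_exp)
qed

text \<open>
  A product of one-dimensional weights serves as the standard integrable majorant: its integral
  factors, and a bound by it amounts to the boundedness of a product of factors \<open>1 + x\<^sub>b\<^sup>2\<close>, which
  can be gained one coordinate at a time.
\<close>

definition decay_weight :: "'a::euclidean_space \<Rightarrow> real" where
  "decay_weight x = (\<Prod>b\<in>Basis. inverse (1 + (x \<bullet> b)\<^sup>2))"

lemma decay_weight_pos: "decay_weight x > 0"
  unfolding decay_weight_def by (intro prod_pos) (auto simp: add_pos_nonneg)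

lemma integrable_decay_weight: "integrable lborel (decay_weight :: 'a::euclidean_space \<Rightarrow> real)"
proof -
  have "einterval (-\<infinity>) \<infinity> = UNIV" by (auto simp: einterval_def)
  then have int: "integrable lborel (\<lambda>x::real. inverse (1 + x\<^sup>2))"
    using integrable_inverse_1_plus_square by (simp add: set_integrable_def)
  have nn: "ennreal (decay_weight x) = (\<Prod>b\<in>Basis. ennreal (inverse (1 + (x \<bullet> b)\<^sup>2)))" for x :: 'a
    unfolding decay_weight_def by (intro prod_ennreal[symmetric]) auto
  have "(\<integral>\<^sup>+x. ennreal (decay_weight (x::'a)) \<partial>lborel)
      = (\<Prod>b\<in>(Basis::'a set). (\<integral>\<^sup>+x. ennreal (inverse (1 + x\<^sup>2)) \<partial>lborel))"
    unfolding nn by (rule nn_integral_lborel_prod) auto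
  also have "\<dots> < \<infinity>"
    using int by (simp add: integrable_iff_bounded power_less_top_ennreal)
  finally show ?thesis
    using decay_weight_pos[where 'a='a]
    by (intro integrableI_bounded) (auto simp: decay_weight_def[abs_def] less_imp_le)
qed

lemma decay_weight_mult: "decay_weight x * (\<Prod>b\<in>Basis. 1 + (x \<bullet> b)\<^sup>2) = 1"
  unfolding decay_weight_def prod.distrib[symmetric]
  by (rule prod.neutral) (simp add: add_nonneg_eq_0_iff)

lemma decay_weight_bound:
  fixes x :: "'a::euclidean_space"
  assumes "(1 + norm x) ^ (2 * DIM('a)) * r \<le> B" "0 \<le> r"
  shows "r \<le> B * decay_weight x"
proof -
  have "(\<Prod>b\<in>(Basis::'a set). 1 + (x \<bullet> b)\<^sup>2) \<le> (\<Prod>b\<in>(Basis::'a set). (1 + norm x)\<^sup>2)"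
  proof (rule prod_mono, intro conjI)
    fix b :: 'a assume "b \<in> Basis"
    then have "\<bar>x \<bullet> b\<bar>\<^sup>2 \<le> (norm x)\<^sup>2" by (intro power_mono Basis_le_norm) auto
    then show "1 + (x \<bullet> b)\<^sup>2 \<le> (1 + norm x)\<^sup>2" by (simp add: power2_sum add_increasing2)
  qed auto
  then have "(\<Prod>b\<in>(Basis::'a set). 1 + (x \<bullet> b)\<^sup>2) * r \<le> (1 + norm x) ^ (2 * DIM('a)) * r"
    using assms(2) by (intro mult_right_mono) (simp_all add: power_mult)
  also note assms(1)
  finally have *: "(\<Prod>b\<in>(Basis::'a set). 1 + (x \<bullet> b)\<^sup>2) * r \<le> B" .
  then have "((\<Prod>b\<in>(Basis::'a set). 1 + (x \<bullet> b)\<^sup>2) * r) * decay_weight x \<le> B * decay_weight x"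
    using decay_weight_pos[of x] by (intro mult_right_mono) auto
  then show ?thesis
    using decay_weight_mult[of x] by (simp add: mult_ac)
qed

lemma schwartz_partial_deriv:
  assumes "schwartz f" "b \<in> Basis"
  shows "schwartz (partial_deriv b f)"
proof -
  have "partial_derivs bs (partial_deriv b f) = partial_derivs (bs @ [b]) f" for bs
    by (simp add: partial_derivs_def)
  then show ?thesis
    using assms unfolding schwartz_def by simp
qed

lemma schwartz_differentiable: "schwartz f \<Longrightarrow> f differentiable (at x)"
  unfolding schwartz_def by (drule spec[of _ "[]"]) (simp add: partial_derivs_def)

lemma schwartz_bound:
  assumes "schwartz f"
  obtains B where "B \<ge> 0" "\<And>x. (1 + norm x) ^ N * norm (f x) \<le> B"
proof -
  obtain B where B: "\<And>x. (1 + norm x) ^ N * norm (f x) \<le> B"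
    using assms unfolding schwartz_def
    by (elim allE[of _ "[]"]) (auto simp: partial_derivs_def dest!: spec[of _ N])
  have "0 \<le> (1 + norm (0::'a)) ^ N * norm (f 0)" by simp
  also note B
  finally show ?thesis using B that by blast
qed

lemma schwartz_measurable:
  assumes "schwartz f"
  shows "f \<in> borel_measurable borel"
proof -
  have "continuous_on UNIV f"
    using schwartz_differentiable[OF assms]
    by (intro differentiable_imp_continuous_on differentiable_at_imp_differentiable_on)
  then show ?thesis by (rule borel_measurable_continuous_onI)
qed

lemma integrable_schwartz:
  fixes f :: "'a::euclidean_space \<Rightarrow> complex"
  assumes "schwartz f"
  shows "integrable lborel f"
proof -
  obtain B where "\<And>x. (1 + norm x) ^ (2 * DIM('a)) * norm (f x) \<le> B"
    using schwartz_bound[OF assms] by blast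
  then have "norm (f x) \<le> B * decay_weight x" for x
    by (rule decay_weight_bound) auto
  then have "norm (f x) \<le> norm (B * decay_weight x)" for x
    by (metis norm_ge_zero order_trans abs_ge_self real_norm_def)
  then show ?thesis
    using integrable_decay_weight schwartz_measurable[OF assms]
    by (intro Bochner_Integration.integrable_bound[of _ "\<lambda>x. B * decay_weight x" f]) auto
qed

lemma has_derivative_partial_deriv:
  fixes f :: "'a::euclidean_space \<Rightarrow> complex"
  assumes "f differentiable (at (x + t *\<^sub>R b))"
  shows "((\<lambda>t. f (x + t *\<^sub>R b)) has_derivative (\<lambda>h. h *\<^sub>R partial_deriv b f (x + t *\<^sub>R b))) (at t)"
proof -
  let ?D = "frechet_derivative f (at (x + t *\<^sub>R b))"
  have D: "(f has_derivative ?D) (at (x + t *\<^sub>R b))"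
    using assms by (simp add: frechet_derivative_works)
  have "((\<lambda>t. x + t *\<^sub>R b) has_derivative (\<lambda>h. h *\<^sub>R b)) (at t)"
    by (auto intro!: derivative_eq_intros)
  from has_derivative_compose[OF this D]
  have "((\<lambda>t. f (x + t *\<^sub>R b)) has_derivative (\<lambda>h. ?D (h *\<^sub>R b))) (at t)" .
  moreover have "?D (h *\<^sub>R b) = h *\<^sub>R partial_deriv b f (x + t *\<^sub>R b)" for h
    using has_derivative_linear[OF D] by (simp add: partial_deriv_def linear_scale)
  ultimately show ?thesis by simp
qed

text \<open>
  An integrable majorant for the difference quotients, as needed for differentiating under the
  integral sign. By the mean value theorem a quotient is at most the size of the derivative at a point
  within distance 1 of \<open>x\<close>; moving the base point that far changes \<open>1 + |x|\<close> by at most a factor 2.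
\<close>

lemma schwartz_diff_quotient_bound:
  fixes f :: "'a::euclidean_space \<Rightarrow> complex"
  assumes f: "schwartz f" and b: "b \<in> Basis"
  obtains B where "\<And>x h. 0 < h \<Longrightarrow> h \<le> 1 \<Longrightarrow>
    norm ((f (x + h *\<^sub>R b) - f x) /\<^sub>R h) \<le> B * decay_weight x"
proof -
  let ?N = "2 * DIM('a)"
  obtain B where B: "B \<ge> 0" "\<And>x. (1 + norm x) ^ ?N * norm (partial_deriv b f x) \<le> B"
    using schwartz_bound[OF schwartz_partial_deriv[OF f b]] by blast
  have "norm ((f (x + h *\<^sub>R b) - f x) /\<^sub>R h) \<le> (2 ^ ?N * B) * decay_weight x"
    if h: "0 < h" "h \<le> 1" for x :: 'a and h
  proof (rule decay_weight_bound)
    let ?g = "\<lambda>t. f (x + t *\<^sub>R b)"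
    have D: "(?g has_derivative (\<lambda>h. h *\<^sub>R partial_deriv b f (x + t *\<^sub>R b))) (at t)" for t
      using schwartz_differentiable[OF f] by (rule has_derivative_partial_deriv)
    then have "continuous_on {0..h} ?g"
      by (meson continuous_at_imp_continuous_on has_derivative_continuous)
    from mvt_general[OF h(1) this D] obtain t where t: "0 < t" "t < h"
      "norm (?g h - ?g 0) \<le> norm ((h - 0) *\<^sub>R partial_deriv b f (x + t *\<^sub>R b))" by auto
    define y where "y = x + t *\<^sub>R b"
    have le: "norm ((f (x + h *\<^sub>R b) - f x) /\<^sub>R h) \<le> norm (partial_deriv b f y)"
      using h t(3) by (simp add: y_def inverse_eq_divide pos_divide_le_eq mult.commute)
    have "norm x \<le> norm y + norm (t *\<^sub>R b)"
      unfolding y_def by (metis add_diff_cancel norm_triangle_ineq4)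
    also have "\<dots> \<le> norm y + 1" using t h b by simp
    finally have le': "norm x \<le> norm y + 1" .
    have "r \<le> c + 1 \<Longrightarrow> 0 \<le> c \<Longrightarrow> 1 + r \<le> 2 * (1 + c)" for r c :: real by simp
    from this[OF le' norm_ge_zero] have "1 + norm x \<le> 2 * (1 + norm y)" .
    then have "(1 + norm x) ^ ?N \<le> (2 * (1 + norm y)) ^ ?N"
      by (intro power_mono) auto
    with le have "(1 + norm x) ^ ?N * norm ((f (x + h *\<^sub>R b) - f x) /\<^sub>R h) \<le>
       (2 * (1 + norm y)) ^ ?N * norm (partial_deriv b f y)"
      by (intro mult_mono) auto
    also have "\<dots> = 2 ^ ?N * ((1 + norm y) ^ ?N * norm (partial_deriv b f y))"
      by (simp only: power_mult_distrib mult.assoc)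
    also have "\<dots> \<le> 2 ^ ?N * B" by (intro mult_left_mono B) auto
    finally show "(1 + norm x) ^ ?N * norm ((f (x + h *\<^sub>R b) - f x) /\<^sub>R h) \<le> 2 ^ ?N * B" .
  qed auto
  then show ?thesis using that by blast
qed

lemma fourier_translate:
  fixes f :: "'a::euclidean_space \<Rightarrow> complex"
  assumes [measurable]: "f \<in> borel_measurable borel"
  shows "fourier (\<lambda>x. f (x + a)) \<xi> = cis (a \<bullet> \<xi>) * fourier f \<xi>"
proof -
  have "fourier (\<lambda>x. f (x + a)) \<xi> = (LINT x|lborel. cis (a \<bullet> \<xi>) * (cis (- ((x + a) \<bullet> \<xi>)) * f (x + a)))"
    by (subst fourier_eq_lborel) (auto simp: mult.assoc[symmetric] cis_mult inner_add_left)
  also have "\<dots> = cis (a \<bullet> \<xi>) * (LINT x|lborel. cis (- ((x + a) \<bullet> \<xi>)) * f (x + a))"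
    by simp
  also have "(LINT x|lborel. cis (- ((x + a) \<bullet> \<xi>)) * f (x + a)) = (LINT x|lborel. cis (- (x \<bullet> \<xi>)) * f x)"
    by (rule integral_lborel_translate) (simp add: cis_conv_exp)
  finally show ?thesis by (simp add: fourier_eq_lborel)
qed

lemma diff_quotient_tendsto:
  fixes g :: "real \<Rightarrow> complex"
  assumes "(g has_vector_derivative v) (at 0)"
  shows "((\<lambda>t. (g t - g 0) /\<^sub>R t) \<longlongrightarrow> v) (at 0)"
proof -
  have "((\<lambda>h. norm (g h - g 0 - h *\<^sub>R v) / norm h) \<longlongrightarrow> 0) (at 0)"
    using assms by (simp add: has_vector_derivative_def has_derivative_at)
  then have "((\<lambda>h. norm ((g h - g 0) /\<^sub>R h - v)) \<longlongrightarrow> 0) (at 0)"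
  proof (rule Lim_transform_eventually)
    show "\<forall>\<^sub>F h in at 0. norm (g h - g 0 - h *\<^sub>R v) / norm h = norm ((g h - g 0) /\<^sub>R h - v)"
    proof (rule eventually_at_filter[THEN iffD2, OF always_eventually], intro allI impI)
      fix h :: real assume "h \<noteq> 0"
      then have "(g h - g 0) /\<^sub>R h - v = (g h - g 0 - h *\<^sub>R v) /\<^sub>R h"
        by (simp add: scaleR_diff_right)
      then show "norm (g h - g 0 - h *\<^sub>R v) / norm h = norm ((g h - g 0) /\<^sub>R h - v)"
        by (simp add: divide_inverse mult.commute)
    qed
  qed
  from LIM_zero_cancel[OF tendsto_norm_zero_cancel[OF this]] show ?thesis .
qed

text \<open>
  The Fourier transform of a difference quotient is known exactly from \<open>fourier_translate\<close>; letting
  the step tend to 0 on both sides gives the rule without an integration by parts.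
\<close>

lemma fourier_partial_deriv:
  fixes f :: "'a::euclidean_space \<Rightarrow> complex"
  assumes f: "schwartz f" and b: "b \<in> Basis"
  shows "fourier (partial_deriv b f) \<xi> = \<i> * complex_of_real (\<xi> \<bullet> b) * fourier f \<xi>"
proof (rule LIMSEQ_unique)
  define h where "h n = inverse (real (Suc n))" for n
  define D where "D n x = (f (x + h n *\<^sub>R b) - f x) /\<^sub>R h n" for n x
  have h: "0 < h n" "h n \<le> 1" for n by (auto simp: h_def field_simps)
  have h0: "filterlim h (at 0) sequentially"
    unfolding filterlim_at using h LIMSEQ_inverse_real_of_nat
    by (auto simp: h_def[abs_def] intro: always_eventually)
  note [measurable] = schwartz_measurable[OF f] schwartz_measurable[OF schwartz_partial_deriv[OF f b]]
  have D_meas [measurable]: "D n \<in> borel_measurable borel" for n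
    unfolding D_def by measurable
  obtain B where B: "\<And>x h. 0 < h \<Longrightarrow> h \<le> 1 \<Longrightarrow>
    norm ((f (x + h *\<^sub>R b) - f x) /\<^sub>R h) \<le> B * decay_weight x"
    using schwartz_diff_quotient_bound[OF f b] by blast
  have "(\<lambda>n. LINT x|lborel. cis (- (x \<bullet> \<xi>)) * D n x) \<longlonglongrightarrow>
    (LINT x|lborel. cis (- (x \<bullet> \<xi>)) * partial_deriv b f x)"
  proof (rule integral_dominated_convergence)
    show "integrable lborel (\<lambda>x. B * decay_weight x)"
      by (simp add: integrable_decay_weight)
    show "AE x in lborel. (\<lambda>n. cis (- (x \<bullet> \<xi>)) * D n x) \<longlonglongrightarrow> cis (- (x \<bullet> \<xi>)) * partial_deriv b f x"
    proof (rule AE_I2)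
      fix x
      have "((\<lambda>t. f (x + t *\<^sub>R b)) has_vector_derivative partial_deriv b f x) (at 0)"
        using has_derivative_partial_deriv[OF schwartz_differentiable[OF f], where x=x and t=0 and b=b]
        by (simp add: has_vector_derivative_def)
      then have "((\<lambda>t. (f (x + t *\<^sub>R b) - f x) /\<^sub>R t) \<longlongrightarrow> partial_deriv b f x) (at 0)"
        by (auto dest: diff_quotient_tendsto)
      from filterlim_compose[OF this h0] have "(\<lambda>n. D n x) \<longlonglongrightarrow> partial_deriv b f x"
        by (simp add: D_def)
      then show "(\<lambda>n. cis (- (x \<bullet> \<xi>)) * D n x) \<longlonglongrightarrow> cis (- (x \<bullet> \<xi>)) * partial_deriv b f x"
        by (intro tendsto_intros)
    qed
    show "AE x in lborel. norm (cis (- (x \<bullet> \<xi>)) * D n x) \<le> B * decay_weight x" for n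
      using B[OF h] by (simp add: D_def norm_mult)
  qed (auto simp: cis_conv_exp)
  then show "(\<lambda>n. fourier (D n) \<xi>) \<longlonglongrightarrow> fourier (partial_deriv b f) \<xi>"
    by (simp add: fourier_eq_lborel)
  have "fourier (D n) \<xi> = (cis (h n * (\<xi> \<bullet> b)) - 1) /\<^sub>R h n * fourier f \<xi>" for n
  proof -
    have i: "integrable lborel (\<lambda>x. cis (- (x \<bullet> \<xi>)) * f (x + a))" for a
      using integrable_lborel_translate[OF integrable_schwartz[OF f]] by (rule integrable_cis_mult) simp
    have "fourier (D n) \<xi> = (LINT x|lborel. (cis (- (x \<bullet> \<xi>)) * f (x + h n *\<^sub>R b) - cis (- (x \<bullet> \<xi>)) * f (x + 0)) /\<^sub>R h n)"
      by (subst fourier_eq_lborel) (auto simp: D_def scaleR_diff_right algebra_simps)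
    also have "\<dots> = (fourier (\<lambda>x. f (x + h n *\<^sub>R b)) \<xi> - fourier f \<xi>) /\<^sub>R h n"
      using i by (simp add: fourier_eq_lborel)
        (simp add: Bochner_Integration.integral_diff i[of 0, simplified])
    also have "\<dots> = (cis (h n * (\<xi> \<bullet> b)) - 1) /\<^sub>R h n * fourier f \<xi>"
      by (simp add: fourier_translate inner_commute algebra_simps)
    finally show ?thesis .
  qed
  moreover have "(\<lambda>n. (cis (h n * (\<xi> \<bullet> b)) - 1) /\<^sub>R h n * fourier f \<xi>) \<longlonglongrightarrow> \<i> * complex_of_real (\<xi> \<bullet> b) * fourier f \<xi>"
  proof -
    have "((\<lambda>t. cis (t * (\<xi> \<bullet> b))) has_vector_derivative \<i> * complex_of_real (\<xi> \<bullet> b)) (at 0)"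
      unfolding cis_conv_exp of_real_mult
      by (rule has_vector_derivative_real_field[where f="\<lambda>z. exp (\<i> * (z * complex_of_real (\<xi> \<bullet> b)))"])
        (auto intro!: derivative_eq_intros)
    then have "((\<lambda>t. (cis (t * (\<xi> \<bullet> b)) - 1) /\<^sub>R t) \<longlongrightarrow> \<i> * complex_of_real (\<xi> \<bullet> b)) (at 0)"
      by (auto dest: diff_quotient_tendsto)
    from filterlim_compose[OF this h0] show ?thesis by (intro tendsto_intros)
  qed
  ultimately show "(\<lambda>n. fourier (D n) \<xi>) \<longlonglongrightarrow> \<i> * complex_of_real (\<xi> \<bullet> b) * fourier f \<xi>"
    by simp
qed

text \<open>
  Induction on the set of directions. One more factor \<open>1 + \<xi>\<^sub>b\<^sup>2\<close> costs two derivatives: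
  \<open>(1 + \<xi>\<^sub>b\<^sup>2) |f^(\<xi>)|\<close> is the sum of the absolute values of the transforms of \<open>f\<close> and of \<open>\<partial>\<^sub>b \<partial>\<^sub>b f\<close>,
  and both are Schwartz functions, so the induction hypothesis applies to each. For this reason
  \<open>f\<close> is generalized in the induction.
\<close>

lemma fourier_schwartz_bound:
  fixes f :: "'a::euclidean_space \<Rightarrow> complex"
  assumes "finite B" "B \<subseteq> Basis" "schwartz f"
  shows "\<exists>C. \<forall>\<xi>. norm (fourier f \<xi>) * (\<Prod>b\<in>B. 1 + (\<xi> \<bullet> b)\<^sup>2) \<le> C"
  using assms
proof (induction B arbitrary: f rule: finite_induct)
  case empty
  then show ?case using norm_fourier_le[OF integrable_schwartz] by auto
next
  case (insert b B)
  let ?P = "\<lambda>\<xi>. \<Prod>b\<in>B. 1 + (\<xi> \<bullet> b)\<^sup>2"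
  have b: "b \<in> Basis" and f: "schwartz f" using insert by auto
  let ?g = "partial_deriv b (partial_deriv b f)"
  have g: "schwartz ?g" using f b by (intro schwartz_partial_deriv)
  obtain C1 where C1: "\<And>\<xi>. norm (fourier f \<xi>) * ?P \<xi> \<le> C1"
    using insert.IH[OF _ f] insert.prems by auto
  obtain C2 where C2: "\<And>\<xi>. norm (fourier ?g \<xi>) * ?P \<xi> \<le> C2"
    using insert.IH[OF _ g] insert.prems by auto
  have "norm (fourier f \<xi>) * (\<Prod>b\<in>insert b B. 1 + (\<xi> \<bullet> b)\<^sup>2) \<le> C1 + C2" for \<xi>
  proof -
    have "norm (fourier ?g \<xi>) = (\<xi> \<bullet> b)\<^sup>2 * norm (fourier f \<xi>)"
      using f b by (simp add: fourier_partial_deriv schwartz_partial_deriv norm_mult power2_eq_square mult_ac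
          abs_mult[symmetric])
    then have "norm (fourier f \<xi>) * (\<Prod>b\<in>insert b B. 1 + (\<xi> \<bullet> b)\<^sup>2) =
      norm (fourier f \<xi>) * ?P \<xi> + norm (fourier ?g \<xi>) * ?P \<xi>"
      using insert.hyps by (simp add: algebra_simps)
    also have "\<dots> \<le> C1 + C2" by (intro add_mono C1 C2)
    finally show ?thesis .
  qed
  then show ?case by blast
qed

lemma integrable_fourier_schwartz:
  fixes f :: "'a::euclidean_space \<Rightarrow> complex"
  assumes f: "schwartz f"
  shows "integrable lborel (fourier f)"
proof -
  obtain C where C: "\<And>\<xi>. norm (fourier f \<xi>) * (\<Prod>b\<in>Basis. 1 + (\<xi> \<bullet> b)\<^sup>2) \<le> C"
    using fourier_schwartz_bound[OF finite_Basis subset_refl f] by blast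
  have "norm (fourier f \<xi>) \<le> norm (C * decay_weight \<xi>)" for \<xi>
  proof -
    have "norm (fourier f \<xi>) * (\<Prod>b\<in>Basis. 1 + (\<xi> \<bullet> b)\<^sup>2) * decay_weight \<xi> \<le> C * decay_weight \<xi>"
      using C decay_weight_pos[of \<xi>] by (intro mult_right_mono) auto
    then have "norm (fourier f \<xi>) \<le> C * decay_weight \<xi>"
      using decay_weight_mult[of \<xi>] by (metis mult.assoc mult.commute mult.right_neutral)
    then show ?thesis by simp
  qed
  then show ?thesis
    using integrable_decay_weight fourier_measurable[OF schwartz_measurable[OF f]]
    by (intro Bochner_Integration.integrable_bound[of _ "\<lambda>x. C * decay_weight x" "fourier f"]) auto
qed

section \<open>Bessel potentials\<close>

lemma (in pair_sigma_finite) integrable_pair_bound: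
  fixes F :: "'a \<times> 'b \<Rightarrow> complex" and a :: "'a \<Rightarrow> real" and b :: "'b \<Rightarrow> real"
  assumes [measurable]: "F \<in> borel_measurable (M1 \<Otimes>\<^sub>M M2)"
    and a: "integrable M1 a" and b: "integrable M2 b"
    and le: "\<And>x y. norm (F (x, y)) \<le> a x * b y"
  shows "integrable (M1 \<Otimes>\<^sub>M M2) F"
proof (rule integrableI_bounded)
  have [measurable]: "a \<in> borel_measurable M1" "b \<in> borel_measurable M2"
    using a b by auto
  have "ennreal (norm (F (x, y))) \<le> ennreal (norm (a x)) * ennreal (norm (b y))" for x y
    using le[of x y] by (simp add: ennreal_mult[symmetric] abs_mult[symmetric])
  then have "(\<integral>\<^sup>+z. norm (F z) \<partial>(M1 \<Otimes>\<^sub>M M2)) \<le> (\<integral>\<^sup>+x. \<integral>\<^sup>+y. ennreal (norm (a x)) * ennreal (norm (b y)) \<partial>M2 \<partial>M1)"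
    by (subst M2.nn_integral_fst[symmetric]) (auto intro!: nn_integral_mono)
  also have "\<dots> = (\<integral>\<^sup>+x. norm (a x) \<partial>M1) * (\<integral>\<^sup>+y. norm (b y) \<partial>M2)"
    by (simp add: nn_integral_cmult nn_integral_multc)
  also have "\<dots> < \<infinity>"
    using a b by (simp add: integrable_iff_bounded ennreal_mult_less_top)
  finally show "(\<integral>\<^sup>+z. norm (F z) \<partial>(M1 \<Otimes>\<^sub>M M2)) < \<infinity>" .
qed simp

text \<open>
  The heat semigroup as a Fourier multiplier. Unlike general Fourier inversion this is a plain
  interchange of integrals, since the Gaussian makes the double integral absolutely convergent.
\<close>

lemma heat_convolution_fourier:
  fixes g :: "'a::euclidean_space \<Rightarrow> complex"
  assumes g: "integrable lborel g" and s: "s > 0"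
  shows "(LINT \<xi>|lborel. cis (x \<bullet> \<xi>) * complex_of_real (exp (- s * (norm \<xi>)\<^sup>2)) * fourier g \<xi>)
    = complex_of_real ((2 * pi) ^ DIM('a)) * (LINT y|lborel. complex_of_real (heat_kernel s (x - y)) * g y)"
proof -
  have [measurable]: "g \<in> borel_measurable borel" using g by (simp add: integrable_iff_bounded)
  let ?E = "\<lambda>\<xi>::'a. complex_of_real (exp (- s * (norm \<xi>)\<^sup>2))"
  define F where "F \<xi> y = cis ((x - y) \<bullet> \<xi>) * ?E \<xi> * g y" for \<xi> y
  have G: "has_bochner_integral lborel (\<lambda>\<xi>. cis (w \<bullet> \<xi>) * ?E \<xi>)
      (complex_of_real ((2 * pi) ^ DIM('a) * heat_kernel s w))" for w
    using gaussian_fourier[OF s] .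
  have "integrable lborel (\<lambda>\<xi>. norm (?E \<xi>))"
    using G[of 0] by (intro integrable_norm) (simp add: has_bochner_integral_iff)
  moreover have "case_prod F \<in> borel_measurable (lborel \<Otimes>\<^sub>M lborel)"
    unfolding F_def cis_conv_exp by measurable
  ultimately have int: "integrable (lborel \<Otimes>\<^sub>M lborel) (case_prod F)"
    using g by (intro lborel_pair.integrable_pair_bound[where a="\<lambda>\<xi>. norm (?E \<xi>)" and b="\<lambda>y. norm (g y)"])
      (auto simp: F_def norm_mult)
  have "(LINT \<xi>|lborel. cis (x \<bullet> \<xi>) * ?E \<xi> * fourier g \<xi>) = (LINT \<xi>|lborel. (LINT y|lborel. F \<xi> y))"
  proof (intro Bochner_Integration.integral_cong refl)
    fix \<xi> :: 'a
    have split: "cis ((x - y) \<bullet> \<xi>) = cis (x \<bullet> \<xi>) * cis (- (y \<bullet> \<xi>))" for y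
      by (simp add: inner_diff_left cis_mult)
    have "(LINT y|lborel. F \<xi> y) = (LINT y|lborel. (cis (x \<bullet> \<xi>) * ?E \<xi>) * (cis (- (y \<bullet> \<xi>)) * g y))"
      by (intro Bochner_Integration.integral_cong refl)
        (simp only: F_def split mult_ac)
    also have "\<dots> = (cis (x \<bullet> \<xi>) * ?E \<xi>) * (LINT y|lborel. cis (- (y \<bullet> \<xi>)) * g y)"
      by simp
    finally show "cis (x \<bullet> \<xi>) * ?E \<xi> * fourier g \<xi> = (LINT y|lborel. F \<xi> y)"
      by (simp add: fourier_eq_lborel)
  qed
  also have "\<dots> = (LINT y|lborel. (LINT \<xi>|lborel. F \<xi> y))"
    using int by (rule lborel_pair.Fubini_integral[symmetric])
  also have "\<dots> = (LINT y|lborel. complex_of_real ((2 * pi) ^ DIM('a)) * (complex_of_real (heat_kernel s (x - y)) * g y))"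
    using G by (intro Bochner_Integration.integral_cong refl) (simp add: F_def has_bochner_integral_iff)
  finally show ?thesis by simp
qed

text \<open>
  The subordination weight: averaging \<open>e\<^bsup>-sr\<^esup>\<close> against it gives \<open>(1 + r)\<^bsup>-\<gamma>/2\<^esup>\<close>, so it expresses the
  Bessel potential of order \<open>\<gamma>\<close> as an average of the heat semigroup.
\<close>

definition bessel_weight :: "real \<Rightarrow> real \<Rightarrow> real" where
  "bessel_weight \<gamma> s = (if s > 0 then s powr (\<gamma> / 2 - 1) * exp (- s) / Gamma (\<gamma> / 2) else 0)"

lemma bessel_weight_measurable [measurable]: "bessel_weight \<gamma> \<in> borel_measurable borel"
  unfolding bessel_weight_def by measurable

lemma bessel_weight_nonneg: "\<gamma> > 0 \<Longrightarrow> 0 \<le> bessel_weight \<gamma> s"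
  by (simp add: bessel_weight_def less_imp_le)

lemma nn_integral_gamma_scaled:
  fixes a c :: real
  assumes "a > 0" "c > 0"
  shows "(\<integral>\<^sup>+s. ennreal (if s > 0 then s powr (a - 1) * exp (- c * s) else 0) \<partial>lborel) = ennreal (Gamma a * c powr (- a))"
proof -
  let ?f = "\<lambda>t. ennreal (indicator {0..} t * t powr (a - 1) / exp t)"
  have eq: "?f (0 + c * s) = ennreal (c powr (a - 1)) * ennreal (if s > 0 then s powr (a - 1) * exp (- c * s) else 0)" for s
    using assms by (cases "s = 0")
      (auto simp: indicator_def ennreal_mult'[symmetric] powr_mult exp_minus divide_inverse zero_le_mult_iff mult.assoc)
  have "ennreal (Gamma a) = \<bar>c\<bar> * (\<integral>\<^sup>+s. ?f (0 + c * s) \<partial>lborel)"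
    unfolding Gamma_conv_nn_integral_real[OF assms(1)] by (rule nn_integral_real_affine) (use assms in auto)
  also have "\<dots> = ennreal c * (ennreal (c powr (a - 1)) * (\<integral>\<^sup>+s. ennreal (if s > 0 then s powr (a - 1) * exp (- c * s) else 0) \<partial>lborel))"
    using assms unfolding eq by (subst nn_integral_cmult) auto
  also have "\<dots> = ennreal (c powr a) * (\<integral>\<^sup>+s. ennreal (if s > 0 then s powr (a - 1) * exp (- c * s) else 0) \<partial>lborel)"
    using assms by (simp add: mult.assoc[symmetric] ennreal_mult[symmetric] powr_mult_base)
  finally have "ennreal (c powr (- a)) * ennreal (Gamma a) = ennreal (c powr (- a)) * ennreal (c powr a) *
      (\<integral>\<^sup>+s. ennreal (if s > 0 then s powr (a - 1) * exp (- c * s) else 0) \<partial>lborel)"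
    by (simp add: mult.assoc)
  also have "ennreal (c powr (- a)) * ennreal (c powr a) = 1"
    using assms by (simp add: ennreal_mult[symmetric] powr_add[symmetric])
  finally show ?thesis using Gamma_real_pos[OF assms(1)] by (simp add: ennreal_mult mult.commute)
qed

lemma nn_integral_bessel_weight:
  assumes "\<gamma> > 0" "r \<ge> 0"
  shows "(\<integral>\<^sup>+s. ennreal (bessel_weight \<gamma> s * exp (- s * r)) \<partial>lborel) = ennreal ((1 + r) powr (- \<gamma> / 2))"
proof -
  have G: "Gamma (\<gamma> / 2) > 0" using assms by simp
  have "ennreal (bessel_weight \<gamma> s * exp (- s * r)) =
     ennreal (1 / Gamma (\<gamma> / 2)) * ennreal (if s > 0 then s powr (\<gamma> / 2 - 1) * exp (- (1 + r) * s) else 0)" for s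
    using G by (auto simp: bessel_weight_def ennreal_mult'[symmetric] exp_add[symmetric] exp_diff[symmetric]
        exp_minus_inverse algebra_simps mult_exp_exp)
  then have "(\<integral>\<^sup>+s. ennreal (bessel_weight \<gamma> s * exp (- s * r)) \<partial>lborel) =
     ennreal (1 / Gamma (\<gamma> / 2)) * ennreal (Gamma (\<gamma> / 2) * (1 + r) powr (- (\<gamma> / 2)))"
    using assms by (simp add: nn_integral_cmult nn_integral_gamma_scaled del: exp_minus)
  also have "\<dots> = ennreal ((1 + r) powr (- \<gamma> / 2))"
    using G by (simp add: ennreal_mult'[symmetric])
  finally show ?thesis .
qed

lemma has_bochner_integral_bessel_weight:
  assumes "\<gamma> > 0" "r \<ge> 0"
  shows "has_bochner_integral lborel (\<lambda>s. bessel_weight \<gamma> s * exp (- s * r)) ((1 + r) powr (- \<gamma> / 2))"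
  using assms nn_integral_bessel_weight[OF assms]
  by (intro has_bochner_integral_nn_integral) (auto simp: bessel_weight_nonneg)

text \<open>
  Defined with values in \<open>ennreal\<close> because the kernel is infinite at the origin when \<open>\<gamma>\<close> does not
  exceed the dimension.
\<close>

definition bessel_kernel :: "real \<Rightarrow> 'a::euclidean_space \<Rightarrow> ennreal" where
  "bessel_kernel \<gamma> x = (\<integral>\<^sup>+s. ennreal (bessel_weight \<gamma> s) * ennreal (heat_kernel s x) \<partial>lborel)"

lemma bessel_kernel_measurable [measurable]: "bessel_kernel \<gamma> \<in> borel_measurable borel"
  unfolding bessel_kernel_def by measurable

lemma nn_integral_bessel_kernel:
  assumes "\<gamma> > 0"
  shows "(\<integral>\<^sup>+x. bessel_kernel \<gamma> (x::'a::euclidean_space) \<partial>lborel) = 1"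
proof -
  have "(\<integral>\<^sup>+x. bessel_kernel \<gamma> (x::'a) \<partial>lborel) =
    (\<integral>\<^sup>+s. (\<integral>\<^sup>+x. ennreal (bessel_weight \<gamma> s) * ennreal (heat_kernel s (x::'a)) \<partial>lborel) \<partial>lborel)"
    unfolding bessel_kernel_def by (rule lborel_pair.Fubini') measurable
  also have "\<dots> = (\<integral>\<^sup>+s. ennreal (bessel_weight \<gamma> s * exp (- s * 0)) \<partial>lborel)"
  proof (intro nn_integral_cong)
    fix s :: real
    show "(\<integral>\<^sup>+x. ennreal (bessel_weight \<gamma> s) * ennreal (heat_kernel s (x::'a)) \<partial>lborel) = ennreal (bessel_weight \<gamma> s * exp (- s * 0))"
      by (cases "s > 0") (auto simp: nn_integral_cmult nn_integral_heat_kernel bessel_weight_def)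
  qed
  also have "\<dots> = 1" using nn_integral_bessel_weight[OF assms, of 0] by simp
  finally show ?thesis .
qed

lemma integral_norm_le_nn_integral:
  fixes f :: "'a \<Rightarrow> complex"
  shows "ennreal (norm (integral\<^sup>L M f)) \<le> (\<integral>\<^sup>+x. ennreal (norm (f x)) \<partial>M)"
  by (cases "integrable M f") (auto simp: integral_norm_bound_ennreal not_integrable_integral_eq)

text \<open>
  Both sides are averages over \<open>s\<close>: writing the symbol as a subordinated Gaussian and interchanging
  integrals represents the potential as the average of the heat extensions of \<open>g\<close>, and the absolute
  value can then be taken inside. The interchange of \<open>s\<close> and \<open>\<xi>\<close> is where the integrability of the
  Fourier transform of \<open>g\<close> is used.
\<close>

lemma bessel_potential_bound:
  fixes g :: "'a::euclidean_space \<Rightarrow> complex"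
  assumes g: "integrable lborel g" and Fg: "integrable lborel (fourier g)" and \<gamma>: "\<gamma> > 0"
  shows "ennreal (norm (fourier_multiplier (bessel_symbol (- \<gamma>)) g x)) \<le>
    (\<integral>\<^sup>+y. bessel_kernel \<gamma> (x - y) * ennreal (norm (g y)) \<partial>lborel)"
proof -
  have [measurable]: "g \<in> borel_measurable borel" using g by (simp add: integrable_iff_bounded)
  have [measurable]: "fourier g \<in> borel_measurable borel" by (rule fourier_measurable) simp
  define c where "c = (2 * pi) ^ DIM('a)"
  have c: "c > 0" by (simp add: c_def)
  let ?w = "bessel_weight \<gamma>"
  define F where "F s \<xi> = complex_of_real (?w s) * (cis (x \<bullet> \<xi>) * complex_of_real (exp (- s * (norm \<xi>)\<^sup>2)) * fourier g \<xi>)"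
    for s and \<xi> :: 'a
  have "integrable lborel (\<lambda>s. ?w s * exp (- s * 0))"
    using has_bochner_integral_bessel_weight[OF \<gamma>, of 0] by (simp add: has_bochner_integral_iff)
  then have w: "integrable lborel ?w" by simp
  have int: "integrable (lborel \<Otimes>\<^sub>M lborel) (case_prod F)"
  proof (rule lborel_pair.integrable_pair_bound[where a="?w" and b="\<lambda>\<xi>. norm (fourier g \<xi>)"])
    show "case_prod F \<in> borel_measurable (lborel \<Otimes>\<^sub>M lborel)"
      unfolding F_def cis_conv_exp by measurable
    show "norm (case_prod F (s, \<xi>)) \<le> ?w s * norm (fourier g \<xi>)" for s \<xi>
    proof (cases "s > 0")
      case True
      then have "exp (- (s * (norm \<xi>)\<^sup>2)) * norm (fourier g \<xi>) \<le> 1 * norm (fourier g \<xi>)"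
        by (intro mult_right_mono) auto
      then show ?thesis
        using bessel_weight_nonneg[OF \<gamma>, of s] by (auto simp: F_def norm_mult intro!: mult_left_mono)
    qed (simp add: F_def bessel_weight_def)
  qed (use w Fg in auto)
  have "fourier_multiplier (bessel_symbol (- \<gamma>)) g x =
      complex_of_real (1 / c) * (LINT \<xi>|lborel. cis (x \<bullet> \<xi>) * (complex_of_real (bessel_symbol (- \<gamma>) \<xi>) * fourier g \<xi>))"
    unfolding fourier_multiplier_def inv_fourier_def c_def cis_conv_exp bessel_symbol_def
    by (subst integral_completion) simp_all
  also have "(LINT \<xi>|lborel. cis (x \<bullet> \<xi>) * (complex_of_real (bessel_symbol (- \<gamma>) \<xi>) * fourier g \<xi>))
     = (LINT \<xi>|lborel. (LINT s|lborel. F s \<xi>))"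
  proof (intro Bochner_Integration.integral_cong refl)
    fix \<xi> :: 'a
    have "(LINT s|lborel. F s \<xi>) = (LINT s|lborel. complex_of_real (?w s * exp (- s * (norm \<xi>)\<^sup>2)) * (cis (x \<bullet> \<xi>) * fourier g \<xi>))"
      by (intro Bochner_Integration.integral_cong refl) (simp add: F_def mult_ac)
    also have "\<dots> = complex_of_real (LINT s|lborel. ?w s * exp (- s * (norm \<xi>)\<^sup>2)) * (cis (x \<bullet> \<xi>) * fourier g \<xi>)"
      by (simp del: of_real_mult)
    also have "(LINT s|lborel. ?w s * exp (- s * (norm \<xi>)\<^sup>2)) = bessel_symbol (- \<gamma>) \<xi>"
      using has_bochner_integral_bessel_weight[OF \<gamma>, of "(norm \<xi>)\<^sup>2"]
      by (simp add: has_bochner_integral_iff bessel_symbol_def)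
    finally show "cis (x \<bullet> \<xi>) * (complex_of_real (bessel_symbol (- \<gamma>) \<xi>) * fourier g \<xi>) = (LINT s|lborel. F s \<xi>)"
      by (simp add: mult_ac)
  qed
  also have "\<dots> = (LINT s|lborel. (LINT \<xi>|lborel. F s \<xi>))"
    by (rule lborel_pair.Fubini_integral[OF int])
  also have "\<dots> = (LINT s|lborel. complex_of_real c * (complex_of_real (?w s) * (LINT y|lborel. complex_of_real (heat_kernel s (x - y)) * g y)))"
  proof (intro Bochner_Integration.integral_cong refl)
    fix s :: real
    have "(LINT \<xi>|lborel. F s \<xi>) = complex_of_real (?w s) *
       (LINT \<xi>|lborel. cis (x \<bullet> \<xi>) * complex_of_real (exp (- s * (norm \<xi>)\<^sup>2)) * fourier g \<xi>)"
      unfolding F_def by simp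
    then show "(LINT \<xi>|lborel. F s \<xi>) = complex_of_real c * (complex_of_real (?w s) * (LINT y|lborel. complex_of_real (heat_kernel s (x - y)) * g y))"
      using heat_convolution_fourier[OF g, of s x]
      by (cases "s > 0") (simp_all add: c_def bessel_weight_def mult_ac)
  qed
  finally have eq: "fourier_multiplier (bessel_symbol (- \<gamma>)) g x =
    (LINT s|lborel. complex_of_real (?w s) * (LINT y|lborel. complex_of_real (heat_kernel s (x - y)) * g y))"
    using c by simp
  have "ennreal (norm (fourier_multiplier (bessel_symbol (- \<gamma>)) g x)) \<le>
    (\<integral>\<^sup>+s. ennreal (?w s) * (\<integral>\<^sup>+y. ennreal (heat_kernel s (x - y)) * ennreal (norm (g y)) \<partial>lborel) \<partial>lborel)"
    unfolding eq
  proof (rule order_trans[OF integral_norm_le_nn_integral], rule nn_integral_mono)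
    fix s :: real
    let ?I = "LINT y|lborel. complex_of_real (heat_kernel s (x - y)) * g y"
    show "ennreal (norm (complex_of_real (?w s) * ?I)) \<le>
      ennreal (?w s) * (\<integral>\<^sup>+y. ennreal (heat_kernel s (x - y)) * ennreal (norm (g y)) \<partial>lborel)"
    proof (cases "s > 0")
      case True
      have "ennreal (norm ?I) \<le> (\<integral>\<^sup>+y. ennreal (heat_kernel s (x - y)) * ennreal (norm (g y)) \<partial>lborel)"
        using True by (intro order_trans[OF integral_norm_le_nn_integral])
          (simp add: norm_mult ennreal_mult')
      then show ?thesis
        using bessel_weight_nonneg[OF \<gamma>, of s] by (simp add: norm_mult ennreal_mult' mult_left_mono)
    qed (simp add: bessel_weight_def)
  qed
  also have "\<dots> = (\<integral>\<^sup>+s. (\<integral>\<^sup>+y. ennreal (?w s) * (ennreal (heat_kernel s (x - y)) * ennreal (norm (g y))) \<partial>lborel) \<partial>lborel)"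
    by (intro nn_integral_cong nn_integral_cmult[symmetric]) measurable
  also have "\<dots> = (\<integral>\<^sup>+y. (\<integral>\<^sup>+s. ennreal (?w s) * (ennreal (heat_kernel s (x - y)) * ennreal (norm (g y))) \<partial>lborel) \<partial>lborel)"
    by (rule lborel_pair.Fubini'[symmetric]) measurable
  also have "\<dots> = (\<integral>\<^sup>+y. bessel_kernel \<gamma> (x - y) * ennreal (norm (g y)) \<partial>lborel)"
    unfolding bessel_kernel_def
    by (intro nn_integral_cong, subst nn_integral_multc[symmetric]) (auto simp: mult.assoc)
  finally show ?thesis .
qed

section \<open>Convolution with a bounded integrable kernel\<close>

text \<open>
  Hoelder's inequality for the measure with density \<open>H (x - y)\<close>, up to the factor 2. It follows from
  the elementary \<open>r \<le> l + l\<^bsup>1-p\<^esup> r\<^sup>p\<close>, integrated with a balancing choice of the level \<open>l\<close>; the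
  degenerate case \<open>P = 0\<close>, in which that level would be 0, is separate.
\<close>

lemma convolution_pointwise_bound:
  fixes H :: "'a::euclidean_space \<Rightarrow> ennreal" and f :: "'a \<Rightarrow> complex"
  assumes [measurable]: "H \<in> borel_measurable borel" "f \<in> borel_measurable borel"
    and p: "1 < p" and L: "L > 0" and HL: "(\<integral>\<^sup>+y. H y \<partial>lborel) \<le> ennreal L"
    and P: "(\<integral>\<^sup>+y. H (x - y) * ennreal (norm (f y) powr p) \<partial>lborel) = ennreal P" "P \<ge> 0"
  shows "(\<integral>\<^sup>+y. H (x - y) * ennreal (norm (f y)) \<partial>lborel) \<le> ennreal (2 * L powr (1 - 1 / p) * P powr (1 / p))"
proof (cases "P = 0")
  case True
  have "AE y in lborel. H (x - y) * ennreal (norm (f y) powr p) = 0"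
    using P True by (subst nn_integral_0_iff_AE[symmetric]) auto
  then have "AE y in lborel. H (x - y) * ennreal (norm (f y)) = 0"
    by eventually_elim auto
  then have "(\<integral>\<^sup>+y. H (x - y) * ennreal (norm (f y)) \<partial>lborel) = 0"
    by (subst nn_integral_0_iff_AE) auto
  then show ?thesis by simp
next
  case False
  with P have P0: "P > 0" by simp
  \<comment> \<open>the level at which the two terms of the splitting balance\<close>
  define l where "l = (P / L) powr (1 / p)"
  have l: "l > 0" using P0 L by (simp add: l_def)
  have split: "r \<le> l + l powr (1 - p) * r powr p" if "r \<ge> 0" for r
  proof (cases "r \<le> l")
    case False
    then have "1 \<le> (r / l) powr (p - 1)"
      using l p by (intro ge_one_powr_ge_zero) auto
    then have "r * 1 \<le> r * ((r / l) powr (p - 1))"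
      using that by (intro mult_left_mono)
    also have "\<dots> = l powr (1 - p) * r powr p"
      using False l by (simp add: powr_divide powr_diff field_simps)
    finally show ?thesis using l by simp
  qed (simp add: add_increasing2)
  have "(\<integral>\<^sup>+y. H (x - y) * ennreal (norm (f y)) \<partial>lborel) \<le>
    (\<integral>\<^sup>+y. ennreal l * H (x - y) + ennreal (l powr (1 - p)) * (H (x - y) * ennreal (norm (f y) powr p)) \<partial>lborel)"
  proof (rule nn_integral_mono)
    fix y
    have "H (x - y) * ennreal (norm (f y)) \<le> H (x - y) * ennreal (l + l powr (1 - p) * norm (f y) powr p)"
      by (intro mult_left_mono ennreal_leI split) auto
    also have "\<dots> = ennreal l * H (x - y) + ennreal (l powr (1 - p)) * (H (x - y) * ennreal (norm (f y) powr p))"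
      using l by (simp add: ennreal_plus ennreal_mult' algebra_simps)
    finally show "H (x - y) * ennreal (norm (f y)) \<le>
       ennreal l * H (x - y) + ennreal (l powr (1 - p)) * (H (x - y) * ennreal (norm (f y) powr p))" .
  qed
  also have "\<dots> = ennreal l * (\<integral>\<^sup>+y. H (x - y) \<partial>lborel) + ennreal (l powr (1 - p)) * ennreal P"
    by (simp add: nn_integral_add nn_integral_cmult P)
  also have "(\<integral>\<^sup>+y. H (x - y) \<partial>lborel) = (\<integral>\<^sup>+y. H y \<partial>lborel)"
    by (rule nn_integral_lborel_reflect) simp
  also have "ennreal l * \<dots> + ennreal (l powr (1 - p)) * ennreal P \<le> ennreal l * ennreal L + ennreal (l powr (1 - p)) * ennreal P"
    by (intro add_right_mono mult_left_mono HL) auto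
  also have "\<dots> = ennreal (l * L + l powr (1 - p) * P)"
    using l L P by (simp add: ennreal_mult' ennreal_plus)
  also have "l * L + l powr (1 - p) * P = 2 * L powr (1 - 1 / p) * P powr (1 / p)"
  proof -
    have "l * L = L powr (1 - 1 / p) * P powr (1 / p)"
      using P0 L by (simp add: l_def powr_divide powr_diff)
    moreover have "l powr p = P / L" using P0 L p by (simp add: l_def powr_powr)
    then have "l powr (1 - p) * P = l * L"
      using P0 L l by (simp add: powr_diff)
    ultimately show ?thesis by simp
  qed
  finally show ?thesis .
qed

text \<open>
  A form of Young's inequality. With \<open>P = H * |f|\<^sup>p\<close>, the pointwise bound gives
  \<open>|u|\<^sup>q \<le> c P\<^bsup>q/p\<^esup> \<le> c (sup P)\<^bsup>q/p - 1\<^esup> P\<close>. The boundedness of \<open>H\<close> controls the supremum of \<open>P\<close> and its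
  integrability controls the integral of \<open>P\<close>, in both cases by the integral of \<open>|f|\<^sup>p\<close>.
\<close>

lemma convolution_Lp_Lq_bound:
  fixes H :: "'a::euclidean_space \<Rightarrow> ennreal" and f u :: "'a \<Rightarrow> complex"
  assumes [measurable]: "H \<in> borel_measurable borel" "f \<in> borel_measurable borel"
    and p: "1 < p" "p < q" and M: "M > 0" and L: "L > 0"
    and HM: "\<And>z. H z \<le> ennreal M" and HL: "(\<integral>\<^sup>+y. H y \<partial>lborel) \<le> ennreal L"
    and u: "\<And>x. ennreal (norm (u x)) \<le> (\<integral>\<^sup>+y. H (x - y) * ennreal (norm (f y)) \<partial>lborel)"
  shows "Lp_norm q u \<le>
    ennreal (((2 * L powr (1 - 1 / p)) powr q * M powr (q / p - 1) * L) powr (1 / q)) * Lp_norm p f"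
proof -
  define c where "c = (2 * L powr (1 - 1 / p)) powr q"
  define K where "K = c * M powr (q / p - 1) * L"
  have c: "c > 0" and K: "K > 0" using M L by (auto simp: c_def K_def)
  define F where "F = (\<integral>\<^sup>+y. ennreal (norm (f y) powr p) \<partial>lborel)"
  have F: "Lp_norm p f = (if F = \<infinity> then \<infinity> else ennreal (enn2real F powr (1 / p)))"
    by (simp add: Lp_norm_def F_def Let_def nn_integral_completion)
  show ?thesis
  proof (cases "F = \<infinity>")
    case True
    then show ?thesis using M L by (simp add: F ennreal_mult_top)
  next
    case False
    then obtain r where r: "F = ennreal r" "r \<ge> 0" by (cases F) auto
    define P where "P x = (\<integral>\<^sup>+y. H (x - y) * ennreal (norm (f y) powr p) \<partial>lborel)" for x
    have [measurable]: "P \<in> borel_measurable borel" unfolding P_def by measurable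
    have PM: "P x \<le> ennreal (M * r)" for x
    proof -
      have "P x \<le> (\<integral>\<^sup>+y. ennreal M * ennreal (norm (f y) powr p) \<partial>lborel)"
        unfolding P_def by (intro nn_integral_mono mult_right_mono HM) auto
      also have "\<dots> = ennreal M * F" by (simp add: nn_integral_cmult F_def)
      finally show ?thesis using M r by (simp add: ennreal_mult)
    qed
    have "(\<integral>\<^sup>+x. P x \<partial>lborel) = (\<integral>\<^sup>+y. (\<integral>\<^sup>+x. H (x - y) * ennreal (norm (f y) powr p) \<partial>lborel) \<partial>lborel)"
      unfolding P_def by (rule lborel_pair.Fubini') measurable
    also have "\<dots> = (\<integral>\<^sup>+y. (\<integral>\<^sup>+x. H x \<partial>lborel) * ennreal (norm (f y) powr p) \<partial>lborel)"
    proof (rule nn_integral_cong)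
      fix y
      show "(\<integral>\<^sup>+x. H (x - y) * ennreal (norm (f y) powr p) \<partial>lborel) = (\<integral>\<^sup>+x. H x \<partial>lborel) * ennreal (norm (f y) powr p)"
        using nn_integral_lborel_translate[of H "- y"] by (simp add: nn_integral_multc)
    qed
    also have "\<dots> = (\<integral>\<^sup>+x. H x \<partial>lborel) * F" by (simp add: nn_integral_cmult F_def)
    also have "\<dots> \<le> ennreal L * F" by (intro mult_right_mono HL) auto
    finally have PL: "(\<integral>\<^sup>+x. P x \<partial>lborel) \<le> ennreal (L * r)" using L r by (simp add: ennreal_mult)
    have pt: "ennreal (norm (u x) powr q) \<le> ennreal (c * (M * r) powr (q / p - 1)) * P x" for x
    proof -
      obtain a where a: "P x = ennreal a" "a \<ge> 0" using PM[of x] by (cases "P x") (auto simp: top_unique)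
      have aM: "a \<le> M * r" using PM[of x] a M r by (simp add: ennreal_le_iff)
      have "ennreal (norm (u x)) \<le> ennreal (2 * L powr (1 - 1 / p) * a powr (1 / p))"
        using a by (intro order_trans[OF u convolution_pointwise_bound[OF _ _ p(1) L HL]]) (auto simp: P_def)
      then have "norm (u x) \<le> 2 * L powr (1 - 1 / p) * a powr (1 / p)"
        by (subst (asm) ennreal_le_iff) auto
      then have "norm (u x) powr q \<le> (2 * L powr (1 - 1 / p) * a powr (1 / p)) powr q"
        using p by (intro powr_mono2) auto
      also have "\<dots> = c * a powr (q / p)"
        using p by (simp add: c_def powr_mult powr_powr)
      also have "a powr (q / p) = a powr (q / p - 1) * a"
        using a by (cases "a = 0") (auto simp: powr_diff)
      also have "c * \<dots> \<le> c * ((M * r) powr (q / p - 1) * a)"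
        using p a aM c by (intro mult_left_mono mult_right_mono powr_mono2) auto
      finally show ?thesis using a c
        by (simp add: ennreal_mult[symmetric] mult.assoc)
    qed
    have "(\<integral>\<^sup>+x. ennreal (norm (u x) powr q) \<partial>lebesgue) \<le>
      (\<integral>\<^sup>+x. ennreal (c * (M * r) powr (q / p - 1)) * P x \<partial>lebesgue)"
      by (intro nn_integral_mono pt)
    also have "\<dots> = ennreal (c * (M * r) powr (q / p - 1)) * (\<integral>\<^sup>+x. P x \<partial>lborel)"
      by (simp add: nn_integral_completion nn_integral_cmult)
    also have "\<dots> \<le> ennreal (c * (M * r) powr (q / p - 1)) * ennreal (L * r)"
      by (intro mult_left_mono PL) auto
    also have "\<dots> = ennreal (K * r powr (q / p))"
    proof -
      have "c * (M * r) powr (q / p - 1) * (L * r) = K * r powr (q / p)"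
        using r M by (cases "r = 0") (auto simp: K_def powr_mult powr_diff)
      then show ?thesis using c L r by (simp add: ennreal_mult[symmetric])
    qed
    finally have I: "(\<integral>\<^sup>+x. ennreal (norm (u x) powr q) \<partial>lebesgue) \<le> ennreal (K * r powr (q / p))" .
    then obtain I where I': "(\<integral>\<^sup>+x. ennreal (norm (u x) powr q) \<partial>lebesgue) = ennreal I" "I \<ge> 0"
      by (cases "\<integral>\<^sup>+x. ennreal (norm (u x) powr q) \<partial>lebesgue") (auto simp: top_unique)
    have "I \<le> K * r powr (q / p)" using I I' K by (simp add: ennreal_le_iff)
    then have "I powr (1 / q) \<le> (K * r powr (q / p)) powr (1 / q)"
      using p I' by (intro powr_mono2) auto
    also have "\<dots> = K powr (1 / q) * r powr (1 / p)"
      using p K by (simp add: powr_mult powr_powr)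
    finally have "Lp_norm q u \<le> ennreal (K powr (1 / q) * r powr (1 / p))"
      using I' by (simp add: Lp_norm_def ennreal_leI)
    then show ?thesis
      using r by (simp add: F K_def c_def ennreal_mult)
  qed
qed

section \<open>Averaging along a measure with a heat kernel bound\<close>

text \<open>
  The hypothesis says that the image under \<open>\<Phi>\<close> of the measure \<open>\<bar>K\<bar> dM\<close> has heat extension of size
  \<open>s\<^bsup>-\<delta>/2\<^esup>\<close>, as for a measure whose codimension is \<open>\<delta>\<close>. Averaging over \<open>s\<close> against the
  subordination weight converges near 0 precisely because \<open>\<delta> < \<gamma>\<close>, and shows that the kernel \<open>H\<close> below,
  the convolution of the Bessel kernel with this measure, is bounded. Since \<open>H\<close> is also integrable,
  \<open>convolution_Lp_Lq_bound\<close> applies.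
\<close>

theorem bounded_Lp_sobolev_of_heat_bound:
  fixes \<Phi> :: "'b \<Rightarrow> 'a::euclidean_space" and K :: "'b \<Rightarrow> complex"
  assumes M: "sigma_finite_measure M" and \<Phi> [measurable]: "\<Phi> \<in> M \<rightarrow>\<^sub>M borel"
    and K: "integrable M K"
    and heat: "\<And>s z. s > 0 \<Longrightarrow>
      (\<integral>\<^sup>+t. ennreal (norm (K t)) * ennreal (heat_kernel s (z - \<Phi> t)) \<partial>M) \<le> ennreal (A * s powr (- (\<delta> / 2)))"
    and A: "A \<ge> 0" and \<delta>: "\<delta> < \<gamma>" and \<gamma>: "\<gamma> > 0" and p: "1 < p" "p < q"
  shows "bounded_Lp_sobolev (\<lambda>f x. LINT t|M. f (x - \<Phi> t) * K t) p q (- \<gamma>)"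
proof -
  interpret M: sigma_finite_measure M by (rule M)
  interpret Q: pair_sigma_finite "lborel :: 'a measure" M ..
  interpret R: pair_sigma_finite "lborel :: real measure" M ..
  have [measurable]: "K \<in> borel_measurable M" using K by simp
  define k where "k = (LINT t|M. norm (K t))"
  have k: "(\<integral>\<^sup>+t. ennreal (norm (K t)) \<partial>M) = ennreal k" "k \<ge> 0"
    unfolding k_def using K by (auto intro: nn_integral_eq_integral)
  define H where "H z = (\<integral>\<^sup>+t. ennreal (norm (K t)) * bessel_kernel \<gamma> (z - \<Phi> t) \<partial>M)" for z
  have [measurable]: "H \<in> borel_measurable borel" unfolding H_def by measurable
  define B where "B = A * Gamma ((\<gamma> - \<delta>) / 2) / Gamma (\<gamma> / 2)"
  have G: "Gamma (\<gamma> / 2) > 0" "Gamma ((\<gamma> - \<delta>) / 2) > 0" using \<gamma> \<delta> by auto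
  have B: "B \<ge> 0" using A G by (simp add: B_def)
  have HB: "H z \<le> ennreal B" for z
  proof -
    let ?e = "\<lambda>s. ennreal (if s > 0 then s powr ((\<gamma> - \<delta>) / 2 - 1) * exp (- 1 * s) else 0)"
    have "H z = (\<integral>\<^sup>+t. (\<integral>\<^sup>+s. ennreal (norm (K t)) * (ennreal (bessel_weight \<gamma> s) * ennreal (heat_kernel s (z - \<Phi> t))) \<partial>lborel) \<partial>M)"
      unfolding H_def bessel_kernel_def by (intro nn_integral_cong nn_integral_cmult[symmetric]) measurable
    also have "\<dots> = (\<integral>\<^sup>+s. (\<integral>\<^sup>+t. ennreal (norm (K t)) * (ennreal (bessel_weight \<gamma> s) * ennreal (heat_kernel s (z - \<Phi> t))) \<partial>M) \<partial>lborel)"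
      by (rule R.Fubini') measurable
    also have "\<dots> = (\<integral>\<^sup>+s. ennreal (bessel_weight \<gamma> s) * (\<integral>\<^sup>+t. ennreal (norm (K t)) * ennreal (heat_kernel s (z - \<Phi> t)) \<partial>M) \<partial>lborel)"
      by (intro nn_integral_cong, subst nn_integral_cmult[symmetric]) (auto simp: mult_ac)
    also have "\<dots> \<le> (\<integral>\<^sup>+s. ennreal (A / Gamma (\<gamma> / 2)) * ?e s \<partial>lborel)"
    proof (rule nn_integral_mono)
      fix s :: real
      show "ennreal (bessel_weight \<gamma> s) * (\<integral>\<^sup>+t. ennreal (norm (K t)) * ennreal (heat_kernel s (z - \<Phi> t)) \<partial>M)
        \<le> ennreal (A / Gamma (\<gamma> / 2)) * ?e s"
      proof (cases "s > 0")
        case True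
        have "ennreal (bessel_weight \<gamma> s) * (\<integral>\<^sup>+t. ennreal (norm (K t)) * ennreal (heat_kernel s (z - \<Phi> t)) \<partial>M)
           \<le> ennreal (bessel_weight \<gamma> s) * ennreal (A * s powr (- (\<delta> / 2)))"
          by (intro mult_left_mono heat True) auto
        also have "\<dots> = ennreal (bessel_weight \<gamma> s * (A * s powr (- (\<delta> / 2))))"
          using bessel_weight_nonneg[OF \<gamma>] A by (simp add: ennreal_mult)
        also have "bessel_weight \<gamma> s * (A * s powr (- (\<delta> / 2))) = A / Gamma (\<gamma> / 2) * (s powr (\<gamma> / 2 - 1 + (- (\<delta> / 2))) * exp (- s))"
          using True unfolding powr_add bessel_weight_def by simp
        also have "\<gamma> / 2 - 1 + (- (\<delta> / 2)) = (\<gamma> - \<delta>) / 2 - 1" by (simp add: field_simps)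
        finally show ?thesis using True A G by (simp add: ennreal_mult[symmetric])
      qed (simp add: bessel_weight_def)
    qed
    also have "\<dots> = ennreal (A / Gamma (\<gamma> / 2)) * ennreal (Gamma ((\<gamma> - \<delta>) / 2) * 1 powr (- ((\<gamma> - \<delta>) / 2)))"
      using nn_integral_gamma_scaled[of "(\<gamma> - \<delta>) / 2" 1] \<delta> by (subst nn_integral_cmult) simp_all
    also have "\<dots> = ennreal B" using A G by (simp add: B_def ennreal_mult[symmetric])
    finally show ?thesis .
  qed
  have Hk: "(\<integral>\<^sup>+z. H z \<partial>lborel) = ennreal k"
  proof -
    have "(\<integral>\<^sup>+z. H z \<partial>lborel) = (\<integral>\<^sup>+t. (\<integral>\<^sup>+z. ennreal (norm (K t)) * bessel_kernel \<gamma> (z - \<Phi> t) \<partial>lborel) \<partial>M)"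
      unfolding H_def by (rule Q.Fubini'[symmetric]) measurable
    also have "\<dots> = (\<integral>\<^sup>+t. ennreal (norm (K t)) \<partial>M)"
    proof (rule nn_integral_cong)
      fix t
      show "(\<integral>\<^sup>+z. ennreal (norm (K t)) * bessel_kernel \<gamma> (z - \<Phi> t) \<partial>lborel) = ennreal (norm (K t))"
        using nn_integral_lborel_translate[of "bessel_kernel \<gamma>" "- \<Phi> t"] nn_integral_bessel_kernel[OF \<gamma>, where 'a='a]
        by (simp add: nn_integral_cmult)
    qed
    finally show ?thesis using k by simp
  qed
  \<comment> \<open>the shifts by 1 keep both constants positive, even if \<open>K = 0\<close>\<close>
  define C where "C = ((2 * (k + 1) powr (1 - 1 / p)) powr q * (B + 1) powr (q / p - 1) * (k + 1)) powr (1 / q)"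
  have "sobolev_norm q (- \<gamma>) (\<lambda>x. LINT t|M. f (x - \<Phi> t) * K t) \<le> ennreal C * Lp_norm p f"
    if f: "schwartz f" for f :: "'a \<Rightarrow> complex"
  proof -
    define g where "g x = (LINT t|M. f (x - \<Phi> t) * K t)" for x
    note [measurable] = schwartz_measurable[OF f]
    have fi: "integrable lborel f" using f by (rule integrable_schwartz)
    have [measurable]: "g \<in> borel_measurable borel" unfolding g_def by measurable
    have int: "integrable (lborel \<Otimes>\<^sub>M M) (\<lambda>(x, t). cis (a x) * (f (x - \<Phi> t) * K t))"
      if [measurable]: "a \<in> borel_measurable borel" for a
    proof (rule integrableI_bounded)
      show "(\<lambda>(x, t). cis (a x) * (f (x - \<Phi> t) * K t)) \<in> borel_measurable (lborel \<Otimes>\<^sub>M M)"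
        unfolding cis_conv_exp by measurable
      have "(\<integral>\<^sup>+z. norm (case z of (x, t) \<Rightarrow> cis (a x) * (f (x - \<Phi> t) * K t)) \<partial>(lborel \<Otimes>\<^sub>M M)) =
        (\<integral>\<^sup>+t. (\<integral>\<^sup>+x. ennreal (norm (f (x - \<Phi> t))) * ennreal (norm (K t)) \<partial>lborel) \<partial>M)"
        by (subst Q.nn_integral_snd[symmetric]) (auto simp: norm_mult ennreal_mult' cis_conv_exp)
      also have "\<dots> = (\<integral>\<^sup>+t. (\<integral>\<^sup>+x. ennreal (norm (f x)) \<partial>lborel) * ennreal (norm (K t)) \<partial>M)"
      proof (rule nn_integral_cong)
        fix t
        show "(\<integral>\<^sup>+x. ennreal (norm (f (x - \<Phi> t))) * ennreal (norm (K t)) \<partial>lborel) =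
           (\<integral>\<^sup>+x. ennreal (norm (f x)) \<partial>lborel) * ennreal (norm (K t))"
          using nn_integral_lborel_translate[of "\<lambda>x. ennreal (norm (f x))" "- \<Phi> t"]
          by (simp add: nn_integral_multc)
      qed
      also have "\<dots> = (\<integral>\<^sup>+x. ennreal (norm (f x)) \<partial>lborel) * ennreal k"
        using k by (simp add: nn_integral_cmult)
      also have "\<dots> < \<infinity>" using fi by (simp add: integrable_iff_bounded ennreal_mult_less_top)
      finally show "(\<integral>\<^sup>+z. norm (case z of (x, t) \<Rightarrow> cis (a x) * (f (x - \<Phi> t) * K t)) \<partial>(lborel \<Otimes>\<^sub>M M)) < \<infinity>" .
    qed
    have gi: "integrable lborel g"
      using Q.integrable_fst'[OF int[of "\<lambda>_. 0"]] by (simp add: g_def[abs_def])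
    define \<mu> where "\<mu> \<xi> = (LINT t|M. cis (- (\<Phi> t \<bullet> \<xi>)) * K t)" for \<xi>
    have \<mu>_meas [measurable]: "\<mu> \<in> borel_measurable borel"
      unfolding \<mu>_def cis_conv_exp by measurable
    have \<mu>_le: "norm (\<mu> \<xi>) \<le> k" for \<xi>
    proof -
      have "norm (\<mu> \<xi>) \<le> (LINT t|M. norm (cis (- (\<Phi> t \<bullet> \<xi>)) * K t))"
        unfolding \<mu>_def by (rule integral_norm_bound)
      then show ?thesis by (simp add: k_def norm_mult)
    qed
    \<comment> \<open>\<open>g\<close> is a convolution, so its transform is that of \<open>f\<close> times a bounded factor\<close>
    have Fg: "fourier g \<xi> = \<mu> \<xi> * fourier f \<xi>" for \<xi>
    proof -
      have "fourier g \<xi> = (LINT x|lborel. (LINT t|M. cis (- (x \<bullet> \<xi>)) * (f (x - \<Phi> t) * K t)))"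
        by (simp add: fourier_eq_lborel g_def)
      also have "\<dots> = (LINT t|M. (LINT x|lborel. cis (- (x \<bullet> \<xi>)) * (f (x - \<Phi> t) * K t)))"
        by (rule Q.Fubini_integral[symmetric], rule int) simp
      also have "\<dots> = (LINT t|M. cis (- (\<Phi> t \<bullet> \<xi>)) * K t * fourier f \<xi>)"
      proof (intro Bochner_Integration.integral_cong refl)
        fix t
        have "(LINT x|lborel. cis (- (x \<bullet> \<xi>)) * (f (x - \<Phi> t) * K t)) = fourier (\<lambda>x. f (x + (- \<Phi> t))) \<xi> * K t"
          by (subst fourier_eq_lborel) (simp_all add: mult.assoc[symmetric])
        then show "(LINT x|lborel. cis (- (x \<bullet> \<xi>)) * (f (x - \<Phi> t) * K t)) = cis (- (\<Phi> t \<bullet> \<xi>)) * K t * fourier f \<xi>"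
          by (subst (asm) fourier_translate) simp_all
      qed
      also have "\<dots> = \<mu> \<xi> * fourier f \<xi>" by (simp add: \<mu>_def)
      finally show ?thesis .
    qed
    have Ff: "integrable lborel (fourier f)" using f by (rule integrable_fourier_schwartz)
    have [measurable]: "fourier f \<in> borel_measurable borel" by (rule fourier_measurable) simp
    have Fgi: "integrable lborel (fourier g)"
    proof (rule Bochner_Integration.integrable_bound)
      show "integrable lborel (\<lambda>\<xi>. k * norm (fourier f \<xi>))" using Ff by simp
      show "AE \<xi> in lborel. norm (fourier g \<xi>) \<le> norm (k * norm (fourier f \<xi>))"
        using \<mu>_le k by (auto simp: Fg norm_mult intro!: mult_right_mono)
    qed (simp add: Fg[abs_def])
    have [measurable]: "fourier g \<in> borel_measurable borel" by (rule fourier_measurable) simp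
    have Jg: "integrable lborel (\<lambda>\<xi>. complex_of_real (bessel_symbol (- \<gamma>) \<xi>) * fourier g \<xi>)"
    proof (rule Bochner_Integration.integrable_bound[OF Fgi])
      show "AE \<xi> in lborel. norm (complex_of_real (bessel_symbol (- \<gamma>) \<xi>) * fourier g \<xi>) \<le> norm (fourier g \<xi>)"
      proof (rule AE_I2)
        fix \<xi> :: 'a
        have "bessel_symbol (- \<gamma>) \<xi> \<le> 1"
          unfolding bessel_symbol_def using \<gamma> powr_mono[of "- \<gamma> / 2" 0 "1 + (norm \<xi>)\<^sup>2"] by (auto split: if_splits)
        moreover have "bessel_symbol (- \<gamma>) \<xi> \<ge> 0" by (simp add: bessel_symbol_def)
        ultimately show "norm (complex_of_real (bessel_symbol (- \<gamma>) \<xi>) * fourier g \<xi>) \<le> norm (fourier g \<xi>)"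
          by (simp add: norm_mult mult_left_le_one_le)
      qed
    qed (simp add: bessel_symbol_def)
    have "sobolev_norm q (- \<gamma>) g = Lp_norm q (fourier_multiplier (bessel_symbol (- \<gamma>)) g)"
      using gi Jg by (simp add: sobolev_norm_def integrable_completion bessel_symbol_def)
    also have "\<dots> \<le> ennreal C * Lp_norm p f"
      unfolding C_def
    proof (rule convolution_Lp_Lq_bound[where H=H])
      show "H z \<le> ennreal (B + 1)" for z
        using HB[of z] by (rule order_trans) (simp add: ennreal_leI)
      show "(\<integral>\<^sup>+z. H z \<partial>lborel) \<le> ennreal (k + 1)" by (simp add: Hk ennreal_leI)
      fix x
      have "ennreal (norm (fourier_multiplier (bessel_symbol (- \<gamma>)) g x)) \<le>
        (\<integral>\<^sup>+y. bessel_kernel \<gamma> (x - y) * ennreal (norm (g y)) \<partial>lborel)"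
        by (rule bessel_potential_bound[OF gi Fgi \<gamma>])
      also have "\<dots> \<le> (\<integral>\<^sup>+y. (\<integral>\<^sup>+t. bessel_kernel \<gamma> (x - y) * ennreal (norm (f (y - \<Phi> t))) * ennreal (norm (K t)) \<partial>M) \<partial>lborel)"
      proof (rule nn_integral_mono)
        fix y
        have "ennreal (norm (g y)) \<le> (\<integral>\<^sup>+t. ennreal (norm (f (y - \<Phi> t))) * ennreal (norm (K t)) \<partial>M)"
          unfolding g_def by (rule order_trans[OF integral_norm_le_nn_integral]) (simp add: norm_mult ennreal_mult')
        then have "bessel_kernel \<gamma> (x - y) * ennreal (norm (g y)) \<le>
          bessel_kernel \<gamma> (x - y) * (\<integral>\<^sup>+t. ennreal (norm (f (y - \<Phi> t))) * ennreal (norm (K t)) \<partial>M)"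
          by (rule mult_left_mono) simp
        also have "\<dots> = (\<integral>\<^sup>+t. bessel_kernel \<gamma> (x - y) * ennreal (norm (f (y - \<Phi> t))) * ennreal (norm (K t)) \<partial>M)"
          by (subst nn_integral_cmult[symmetric]) (auto simp: mult.assoc)
        finally show "bessel_kernel \<gamma> (x - y) * ennreal (norm (g y)) \<le> \<dots>" .
      qed
      also have "\<dots> = (\<integral>\<^sup>+t. (\<integral>\<^sup>+y. bessel_kernel \<gamma> (x - y) * ennreal (norm (f (y - \<Phi> t))) * ennreal (norm (K t)) \<partial>lborel) \<partial>M)"
        by (rule Q.Fubini'[symmetric]) measurable
      also have "\<dots> = (\<integral>\<^sup>+t. (\<integral>\<^sup>+y. bessel_kernel \<gamma> (x - y - \<Phi> t) * ennreal (norm (f y)) * ennreal (norm (K t)) \<partial>lborel) \<partial>M)"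
      proof (rule nn_integral_cong)
        fix t
        show "(\<integral>\<^sup>+y. bessel_kernel \<gamma> (x - y) * ennreal (norm (f (y - \<Phi> t))) * ennreal (norm (K t)) \<partial>lborel) =
          (\<integral>\<^sup>+y. bessel_kernel \<gamma> (x - y - \<Phi> t) * ennreal (norm (f y)) * ennreal (norm (K t)) \<partial>lborel)"
          using nn_integral_lborel_translate[of "\<lambda>y. bessel_kernel \<gamma> (x - y) * ennreal (norm (f (y - \<Phi> t))) * ennreal (norm (K t))" "\<Phi> t"]
          by (simp add: algebra_simps)
      qed
      also have "\<dots> = (\<integral>\<^sup>+y. (\<integral>\<^sup>+t. bessel_kernel \<gamma> (x - y - \<Phi> t) * ennreal (norm (f y)) * ennreal (norm (K t)) \<partial>M) \<partial>lborel)"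
        by (rule Q.Fubini') measurable
      also have "\<dots> = (\<integral>\<^sup>+y. H (x - y) * ennreal (norm (f y)) \<partial>lborel)"
        unfolding H_def by (intro nn_integral_cong, subst nn_integral_multc[symmetric]) (auto simp: mult_ac)
      finally show "ennreal (norm (fourier_multiplier (bessel_symbol (- \<gamma>)) g x)) \<le>
        (\<integral>\<^sup>+y. H (x - y) * ennreal (norm (f y)) \<partial>lborel)" .
    qed (use p B k in auto)
    finally show ?thesis by (simp add: g_def[abs_def])
  qed
  moreover have "C \<ge> 0" by (simp add: C_def)
  ultimately show ?thesis unfolding bounded_Lp_sobolev_def by blast
qed

section \<open>Singular Gaussian integrals\<close>

lemma nn_integral_abs_powr_Icc:
  fixes \<beta> a :: real
  assumes "\<beta> < 1" "a \<ge> 0"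
  shows "(\<integral>\<^sup>+t. ennreal (\<bar>t\<bar> powr (- \<beta>)) * indicator {-a..a} t \<partial>lborel) \<le> ennreal (2 / (1 - \<beta>) * a powr (1 - \<beta>))"
proof -
  let ?f = "\<lambda>t. ennreal (t powr (- \<beta>)) * indicator {0..a} t"
  have f: "(\<integral>\<^sup>+t. ?f t \<partial>lborel) = ennreal (a powr (1 - \<beta>) / (1 - \<beta>))"
    using has_integral_powr_from_0[of "- \<beta>" a] assms
    by (intro nn_integral_has_integral_lebesgue') auto
  have "(\<integral>\<^sup>+t. ennreal (\<bar>t\<bar> powr (- \<beta>)) * indicator {-a..a} t \<partial>lborel) \<le> (\<integral>\<^sup>+t. ?f t + ?f (0 - t) \<partial>lborel)"
    by (intro nn_integral_mono) (auto simp: indicator_def abs_if)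
  also have "\<dots> = (\<integral>\<^sup>+t. ?f t \<partial>lborel) + (\<integral>\<^sup>+t. ?f (0 - t) \<partial>lborel)"
    by (rule nn_integral_add) auto
  also have "(\<integral>\<^sup>+t. ?f (0 - t) \<partial>lborel) = (\<integral>\<^sup>+t. ?f t \<partial>lborel)"
    by (rule nn_integral_lborel_reflect) auto
  finally show ?thesis
    using assms by (simp add: f ennreal_plus[symmetric] del: ennreal_plus)
qed

definition singular_gauss_const :: "real \<Rightarrow> real" where
  "singular_gauss_const \<beta> = 2 / (1 - \<beta>) + sqrt (4 * pi)"

text \<open>
  Split at \<open>|t| = sqrt s\<close>, the scale of the Gaussian: for smaller \<open>|t|\<close> drop the Gaussian and integrate the
  power, for larger \<open>|t|\<close> replace the power by its value at the splitting point.
\<close>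

lemma nn_integral_singular_gaussian_1dim:
  fixes \<beta> s z :: real
  assumes \<beta>: "0 \<le> \<beta>" "\<beta> < 1" and s: "s > 0"
  shows "(\<integral>\<^sup>+t. ennreal (\<bar>t\<bar> powr (- \<beta>) * exp (- (1 / (4 * s)) * (z - t)\<^sup>2)) \<partial>lborel)
    \<le> ennreal (singular_gauss_const \<beta> * s powr ((1 - \<beta>) / 2))"
proof -
  let ?e = "\<lambda>t. exp (- (1 / (4 * s)) * (z - t)\<^sup>2)"
  have "(\<integral>\<^sup>+t. ennreal (\<bar>t\<bar> powr (- \<beta>) * ?e t) \<partial>lborel) \<le>
    (\<integral>\<^sup>+t. ennreal (\<bar>t\<bar> powr (- \<beta>)) * indicator {-sqrt s..sqrt s} t + ennreal (s powr (- (\<beta> / 2))) * ennreal (?e t) \<partial>lborel)"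
  proof (rule nn_integral_mono)
    fix t
    show "ennreal (\<bar>t\<bar> powr (- \<beta>) * ?e t) \<le> ennreal (\<bar>t\<bar> powr (- \<beta>)) * indicator {-sqrt s..sqrt s} t + ennreal (s powr (- (\<beta> / 2))) * ennreal (?e t)"
    proof (cases "\<bar>t\<bar> \<le> sqrt s")
      case True
      have "\<bar>t\<bar> powr (- \<beta>) * ?e t \<le> \<bar>t\<bar> powr (- \<beta>) * 1"
        using s by (intro mult_left_mono) (auto simp: divide_nonneg_pos)
      then show ?thesis using True by (auto simp: indicator_def abs_le_iff intro!: add_increasing2 ennreal_leI)
    next
      case False
      then have "\<bar>t\<bar> powr (- \<beta>) \<le> sqrt s powr (- \<beta>)"
        using s \<beta> by (intro powr_mono2') auto
      also have "\<dots> = s powr (- (\<beta> / 2))"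
        using s by (simp add: powr_half_sqrt[symmetric] powr_powr)
      finally have "\<bar>t\<bar> powr (- \<beta>) * ?e t \<le> s powr (- (\<beta> / 2)) * ?e t"
        by (rule mult_right_mono) auto
      then have "ennreal (\<bar>t\<bar> powr (- \<beta>) * ?e t) \<le> ennreal (s powr (- (\<beta> / 2)) * ?e t)"
        by (rule ennreal_leI)
      also have "\<dots> = ennreal (s powr (- (\<beta> / 2))) * ennreal (?e t)" by (rule ennreal_mult) auto
      finally show ?thesis by (rule add_increasing[rotated]) simp
    qed
  qed
  also have "\<dots> = (\<integral>\<^sup>+t. ennreal (\<bar>t\<bar> powr (- \<beta>)) * indicator {-sqrt s..sqrt s} t \<partial>lborel) +
     ennreal (s powr (- (\<beta> / 2))) * (\<integral>\<^sup>+t. ennreal (?e t) \<partial>lborel)"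
    by (simp add: nn_integral_add nn_integral_cmult)
  also have "(\<integral>\<^sup>+t. ennreal (?e t) \<partial>lborel) = (\<integral>\<^sup>+t. ennreal (exp (- (1 / (4 * s)) * (norm (t::real))\<^sup>2)) \<partial>lborel)"
    using nn_integral_lborel_reflect[of "\<lambda>t::real. ennreal (exp (- (1 / (4 * s)) * (norm t)\<^sup>2))" z] by simp
  also have "\<dots> = ennreal (sqrt (4 * pi * s))"
    using s by (subst nn_integral_gaussian) (auto simp: mult_ac)
  also have "(\<integral>\<^sup>+t. ennreal (\<bar>t\<bar> powr (- \<beta>)) * indicator {-sqrt s..sqrt s} t \<partial>lborel) + ennreal (s powr (- (\<beta> / 2))) * ennreal (sqrt (4 * pi * s))
     \<le> ennreal (2 / (1 - \<beta>) * sqrt s powr (1 - \<beta>)) + ennreal (s powr (- (\<beta> / 2))) * ennreal (sqrt (4 * pi * s))"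
    using s by (intro add_right_mono nn_integral_abs_powr_Icc \<beta>) auto
  also have "\<dots> = ennreal (2 / (1 - \<beta>) * sqrt s powr (1 - \<beta>) + s powr (- (\<beta> / 2)) * sqrt (4 * pi * s))"
    using s \<beta> by (simp add: ennreal_mult[symmetric] ennreal_plus[symmetric] del: ennreal_plus)
  also have "2 / (1 - \<beta>) * sqrt s powr (1 - \<beta>) + s powr (- (\<beta> / 2)) * sqrt (4 * pi * s) = singular_gauss_const \<beta> * s powr ((1 - \<beta>) / 2)"
  proof -
    have "sqrt s powr (1 - \<beta>) = s powr ((1 - \<beta>) / 2)"
      using s by (simp add: powr_half_sqrt[symmetric] powr_powr)
    moreover have "s powr (- (\<beta> / 2)) * sqrt (4 * pi * s) = sqrt (4 * pi) * s powr ((1 - \<beta>) / 2)"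
    proof -
      have "sqrt (4 * pi * s) = sqrt (4 * pi) * s powr (1 / 2)"
        using s by (simp add: real_sqrt_mult powr_half_sqrt)
      then have "s powr (- (\<beta> / 2)) * sqrt (4 * pi * s) = sqrt (4 * pi) * s powr (- (\<beta> / 2) + 1 / 2)"
        by (simp only: powr_add mult.left_commute)
      also have "- (\<beta> / 2) + 1 / 2 = (1 - \<beta>) / 2" by (simp add: field_simps)
      finally show ?thesis .
    qed
    ultimately show ?thesis by (simp only: singular_gauss_const_def distrib_right)
  qed
  finally show ?thesis .
qed

lemma prod_Basis_cart:
  "(\<Prod>b\<in>(Basis :: (real ^ 'n) set). f b) = (\<Prod>i\<in>UNIV. f (axis i 1))"
proof -
  have *: "(Basis :: (real ^ 'n) set) = (\<lambda>i. axis i 1) ` UNIV" by (auto simp: Basis_vec_def)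
  have "inj (\<lambda>i::'n. axis i (1::real))" by (auto simp: inj_def axis_eq_axis)
  then show ?thesis unfolding * by (subst prod.reindex) (simp_all add: o_def)
qed

lemma nn_integral_singular_gaussian:
  fixes \<beta> :: "'n::finite \<Rightarrow> real" and z :: "real ^ 'n"
  assumes \<beta>: "\<And>i. 0 \<le> \<beta> i" "\<And>i. \<beta> i < 1" and s: "s > 0"
  shows "(\<integral>\<^sup>+t. ennreal ((\<Prod>i\<in>UNIV. \<bar>t $ i\<bar> powr (- \<beta> i)) * exp (- (1 / (4 * s)) * (norm (z - t))\<^sup>2)) \<partial>lborel)
    \<le> ennreal ((\<Prod>i\<in>UNIV. singular_gauss_const (\<beta> i)) * s powr (\<Sum>i\<in>UNIV. (1 - \<beta> i) / 2))"
proof -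
  \<comment> \<open>recovers the index from a basis vector, since the product formula for the integral ranges over \<open>Basis\<close>\<close>
  define idx where "idx b = (SOME i. b = axis i (1::real))" for b :: "real ^ 'n"
  have idx [simp]: "idx (axis i 1) = i" for i
    unfolding idx_def by (rule some_equality) (auto simp: axis_eq_axis)
  define f where "f b x = ennreal (\<bar>x\<bar> powr (- \<beta> (idx b)) * exp (- (1 / (4 * s)) * (z \<bullet> b - x)\<^sup>2))" for b x
  have "ennreal ((\<Prod>i\<in>UNIV. \<bar>t $ i\<bar> powr (- \<beta> i)) * exp (- (1 / (4 * s)) * (norm (z - t))\<^sup>2)) = (\<Prod>b\<in>Basis. f b (t \<bullet> b))" for t
    unfolding f_def exp_norm_sq_eq_prod prod_Basis_cart
    by (subst prod_ennreal) (auto simp: prod.distrib inner_axis inner_diff_left)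
  then have "(\<integral>\<^sup>+t. ennreal ((\<Prod>i\<in>UNIV. \<bar>t $ i\<bar> powr (- \<beta> i)) * exp (- (1 / (4 * s)) * (norm (z - t))\<^sup>2)) \<partial>lborel)
    = (\<integral>\<^sup>+t. (\<Prod>b\<in>Basis. f b (t \<bullet> b)) \<partial>lborel)" by simp
  also have "\<dots> = (\<Prod>b\<in>Basis. (\<integral>\<^sup>+x. f b x \<partial>lborel))"
    by (rule nn_integral_lborel_prod) (auto simp: f_def)
  also have "\<dots> = (\<Prod>i\<in>UNIV. (\<integral>\<^sup>+x. f (axis i 1) x \<partial>lborel))" by (rule prod_Basis_cart)
  also have "\<dots> \<le> (\<Prod>i\<in>UNIV. ennreal (singular_gauss_const (\<beta> i) * s powr ((1 - \<beta> i) / 2)))"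
  proof (rule prod_mono_ennreal)
    show "(\<integral>\<^sup>+x. f (axis i 1) x \<partial>lborel) \<le> ennreal (singular_gauss_const (\<beta> i) * s powr ((1 - \<beta> i) / 2))" for i
      unfolding f_def idx by (rule nn_integral_singular_gaussian_1dim[OF \<beta> s])
  qed
  also have "\<dots> = ennreal (\<Prod>i\<in>UNIV. singular_gauss_const (\<beta> i) * s powr ((1 - \<beta> i) / 2))"
    using \<beta> by (intro prod_ennreal) (auto simp: singular_gauss_const_def less_imp_le)
  also have "(\<Prod>i\<in>UNIV. singular_gauss_const (\<beta> i) * s powr ((1 - \<beta> i) / 2)) =
     (\<Prod>i\<in>UNIV. singular_gauss_const (\<beta> i)) * s powr (\<Sum>i\<in>UNIV. (1 - \<beta> i) / 2)"
    using s by (simp add: prod.distrib powr_sum)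
  finally show ?thesis .
qed

text \<open>
  The exponent of a group is shared equally among its coordinates. Each share is less than 1 exactly
  when the exponent of the group is less than its number of coordinates.
\<close>

lemma prod_group_norm_powr_le:
  fixes t :: "real ^ 'n" and grp :: "'n \<Rightarrow> nat"
  assumes grp: "range grp \<subseteq> I" "finite I" and \<alpha>: "\<And>k. k \<in> I \<Longrightarrow> 0 \<le> \<alpha> k" and t: "\<And>i. t $ i \<noteq> 0"
    and ne: "\<And>k. k \<in> I \<Longrightarrow> \<exists>j. grp j = k"
  shows "(\<Prod>k\<in>I. group_norm grp k t powr (- \<alpha> k)) \<le>
    (\<Prod>i\<in>UNIV. \<bar>t $ i\<bar> powr (- (\<alpha> (grp i) / real (card {j. grp j = grp i}))))"
proof -
  let ?\<beta> = "\<lambda>i. \<alpha> (grp i) / real (card {j. grp j = grp i})"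
  have "group_norm grp k t powr (- \<alpha> k) \<le> (\<Prod>i\<in>{j\<in>UNIV. grp j = k}. \<bar>t $ i\<bar> powr (- ?\<beta> i))" if k: "k \<in> I" for k
  proof -
    let ?G = "{j\<in>UNIV. grp j = k}"
    have le: "\<bar>t $ i\<bar> \<le> group_norm grp k t" if "i \<in> ?G" for i
      using that member_le_L2_set[of ?G i "\<lambda>j. \<bar>t $ j\<bar>"] by (simp add: group_norm_def L2_set_def)
    obtain j where j: "j \<in> ?G" using ne[OF k] by auto
    have pos: "group_norm grp k t > 0" using le[OF j] t[of j] by simp
    have "card ?G > 0" using j by (auto simp: card_gt_0_iff)
    then have "group_norm grp k t powr (- \<alpha> k) = group_norm grp k t powr (\<Sum>i\<in>?G. - (\<alpha> k / real (card ?G)))"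
      using j by auto
    also have "\<dots> = (\<Prod>i\<in>?G. group_norm grp k t powr (- (\<alpha> k / real (card ?G))))"
      using pos by (subst powr_sum) auto
    also have "\<dots> \<le> (\<Prod>i\<in>?G. \<bar>t $ i\<bar> powr (- ?\<beta> i))"
      using \<alpha>[OF k] t le by (intro prod_mono) (auto intro!: powr_mono2')
    finally show ?thesis .
  qed
  then have "(\<Prod>k\<in>I. group_norm grp k t powr (- \<alpha> k)) \<le> (\<Prod>k\<in>I. \<Prod>i\<in>{j\<in>UNIV. grp j = k}. \<bar>t $ i\<bar> powr (- ?\<beta> i))"
    by (intro prod_mono) auto
  also have "\<dots> = (\<Prod>i\<in>UNIV. \<bar>t $ i\<bar> powr (- ?\<beta> i))"
    using grp by (intro prod.group) auto
  finally show ?thesis .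
qed

lemma sum_group_average:
  fixes grp :: "'n::finite \<Rightarrow> nat" and \<alpha> :: "nat \<Rightarrow> real"
  assumes "range grp = I" "finite I"
  shows "(\<Sum>i\<in>UNIV. \<alpha> (grp i) / real (card {j. grp j = grp i})) = (\<Sum>k\<in>I. \<alpha> k)"
proof -
  have "(\<Sum>i\<in>UNIV. \<alpha> (grp i) / real (card {j. grp j = grp i})) =
    (\<Sum>k\<in>I. \<Sum>i\<in>{j\<in>UNIV. grp j = k}. \<alpha> (grp i) / real (card {j. grp j = grp i}))"
    using assms by (intro sum.group[symmetric]) auto
  also have "\<dots> = (\<Sum>k\<in>I. \<alpha> k)"
  proof (rule sum.cong)
    fix k assume "k \<in> I"
    then obtain j where j: "grp j = k" using assms by auto
    then have "card {j. grp j = k} > 0" by (auto simp: card_gt_0_iff)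
    then show "(\<Sum>i\<in>{j\<in>UNIV. grp j = k}. \<alpha> (grp i) / real (card {j. grp j = grp i})) = \<alpha> k"
      using j by auto
  qed simp
  finally show ?thesis .
qed

section \<open>Continuity of real-analytic functions\<close>

text \<open>
  Weierstrass M-test on a closed cube of half the radius: there every term is dominated by its
  absolute value at a corner, where the series converges absolutely.
\<close>

lemma real_analytic_on_imp_continuous_on:
  assumes "real_analytic_on S U"
  shows "continuous_on U S"
proof (rule continuous_at_imp_continuous_on, rule ballI)
  fix a assume "a \<in> U"
  then obtain r c where r: "r > 0" and sum: "\<And>x. (\<forall>i. \<bar>x $ i - a $ i\<bar> < r) \<Longrightarrow>
        ((\<lambda>k. c k * (\<Prod>i\<in>UNIV. (x $ i - a $ i) ^ k i)) has_sum S x) UNIV"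
    using assms unfolding real_analytic_on_def by blast
  define \<rho> where "\<rho> = r / 2"
  have \<rho>: "0 < \<rho>" "\<rho> < r" using r by (auto simp: \<rho>_def)
  define Y where "Y = {x. \<forall>i. \<bar>x $ i - a $ i\<bar> \<le> \<rho>}"
  let ?f = "\<lambda>k x. c k * (\<Prod>i\<in>UNIV. (x $ i - a $ i) ^ k i)"
  define Mk where "Mk k = \<bar>c k * (\<Prod>i\<in>UNIV. \<rho> ^ k i)\<bar>" for k :: "'a \<Rightarrow> nat"
  have "((\<lambda>k. ?f k (\<chi> i. a $ i + \<rho>)) has_sum S (\<chi> i. a $ i + \<rho>)) UNIV"
    using \<rho> by (intro sum) auto
  then have "(\<lambda>k. c k * (\<Prod>i\<in>UNIV. \<rho> ^ k i)) summable_on UNIV"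
    by (auto simp: summable_on_def)
  then have Mk: "Mk summable_on UNIV"
    unfolding Mk_def real_norm_def[symmetric] by (rule summable_on_iff_abs_summable_on_real[THEN iffD1])
  have "uniform_limit Y (\<lambda>X x. \<Sum>k\<in>X. ?f k x) S (finite_subsets_at_top UNIV)"
  proof (rule Weierstrass_m_test_general'[where M=Mk])
    fix k x assume x: "x \<in> Y"
    have "(\<Prod>i\<in>UNIV. \<bar>x $ i - a $ i\<bar> ^ k i) \<le> (\<Prod>i\<in>UNIV. \<rho> ^ k i)"
      using x by (intro prod_mono) (auto simp: Y_def intro!: power_mono)
    then show "norm (?f k x) \<le> Mk k"
      using \<rho> by (auto simp: Mk_def abs_mult abs_prod power_abs intro!: mult_left_mono)
    show "((\<lambda>k. ?f k x) has_sum S x) UNIV"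
    proof (rule sum, rule allI)
      fix i
      have "\<bar>x $ i - a $ i\<bar> \<le> \<rho>" using x by (simp add: Y_def)
      also note \<rho>(2)
      finally show "\<bar>x $ i - a $ i\<bar> < r" .
    qed
  qed (rule Mk)
  then have cont: "continuous_on Y S"
    by (rule uniform_limit_theorem[rotated]) (auto intro!: always_eventually continuous_intros)
  have "ball a \<rho> \<subseteq> Y"
  proof
    fix x assume "x \<in> ball a \<rho>"
    then have "norm (x - a) \<le> \<rho>" by (simp add: dist_norm norm_minus_commute)
    then show "x \<in> Y" unfolding Y_def
      using component_le_norm_cart[of "x - a"] by (auto intro: order_trans)
  qed
  then have "continuous_on (ball a \<rho>) S" using cont by (rule continuous_on_subset[rotated])
  then show "isCont S a" using \<rho> by (simp add: continuous_on_eq_continuous_at)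
qed

section \<open>Changing an integrand on a null set\<close>

text \<open>
  Completeness of Lebesgue measure makes \<open>f\<close> measurable together with \<open>f'\<close>.
  This is used to replace \<open>K\<close> and \<open>S\<close>, given only on parts of the space, by Borel functions.
\<close>

lemma integral_lebesgue_cong_AE_borel:
  fixes f f' :: "'a::euclidean_space \<Rightarrow> complex"
  assumes [measurable]: "f' \<in> borel_measurable borel" and AE: "AE x in lborel. f x = f' x"
  shows "(LINT x|lebesgue. f x) = (LINT x|lborel. f' x)"
proof -
  have f' [measurable]: "f' \<in> borel_measurable lebesgue" by (rule measurable_completion) simp
  have f [measurable]: "f \<in> borel_measurable lebesgue"
  proof (rule measurableI)
    fix A :: "complex set" assume [measurable]: "A \<in> sets borel"
    have [measurable]: "Measurable.pred lebesgue (\<lambda>x. f x \<noteq> f' x)" "Measurable.pred lebesgue (\<lambda>x. f x \<noteq> f' x \<and> f x \<in> A)"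
      using AE by (auto intro!: sets_completion_AE elim: AE_mp)
    have "Measurable.pred lebesgue (\<lambda>x. (f' x \<in> A \<and> \<not> f x \<noteq> f' x) \<or> (f x \<noteq> f' x \<and> f x \<in> A))"
      by measurable
    also have "(\<lambda>x. (f' x \<in> A \<and> \<not> f x \<noteq> f' x) \<or> (f x \<noteq> f' x \<and> f x \<in> A)) = (\<lambda>x. f x \<in> A)"
      by auto
    finally show "f -` A \<inter> space lebesgue \<in> sets lebesgue"
      by (simp add: pred_def vimage_def)
  qed simp
  have "(LINT x|lebesgue. f x) = (LINT x|lebesgue. f' x)"
    using AE by (intro integral_cong_AE) (auto intro: AE_completion)
  also have "\<dots> = (LINT x|lborel. f' x)" by (rule integral_completion) simp
  finally show ?thesis .
qed

lemma AE_lborel_nth_nonzero: "AE t in (lborel :: (real ^ 'n) measure). \<forall>i. t $ i \<noteq> 0"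
proof -
  have "negligible {t :: real ^ 'n. t $ i = 0}" for i
    by (rule negligible_standard_hyperplane_cart)
  then have "AE t in (lebesgue :: (real ^ 'n) measure). t $ i \<noteq> 0" for i
    by (intro AE_I'[of "{t. t $ i = 0}"]) (auto simp: negligible_iff_null_sets)
  then show ?thesis by (simp add: AE_completion_iff AE_all_countable)
qed

section \<open>Singular densities on a graph\<close>

lemma open_nonzero_coords: "open {t :: real ^ 'n. \<forall>i. t $ i \<noteq> 0}"
proof -
  have "{t :: real ^ 'n. \<forall>i. t $ i \<noteq> 0} = (\<Inter>i\<in>UNIV. {t. t $ i \<noteq> 0})" by auto
  also have "open \<dots>" by (intro open_INT ballI open_Collect_neq) (auto intro: continuous_intros)
  finally show ?thesis .
qed

text \<open>
  Dropping the last coordinate from the exponent leaves a Gaussian in the base variables, so the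
  bound is uniform in \<open>S\<close>. The full dimension survives only in the normalizing
  factor \<open>(4\<pi>s)\<^bsup>-(n+1)/2\<^esup>\<close>, against the gain \<open>s\<^bsup>(n - \<Sum>\<beta>)/2\<^esup>\<close> from the integration.
\<close>

lemma nn_integral_singular_kernel_heat_le:
  fixes K :: "real ^ 'n \<Rightarrow> complex" and S :: "real ^ 'n \<Rightarrow> real"
  assumes \<beta>: "\<And>i. 0 \<le> \<beta> i" "\<And>i. \<beta> i < 1" and C: "C \<ge> 0" and s: "s > 0"
    and K: "\<And>t. norm (K t) \<le> C * (\<Prod>i\<in>UNIV. \<bar>t $ i\<bar> powr (- \<beta> i))"
  shows "(\<integral>\<^sup>+t. ennreal (norm (K t)) * ennreal (heat_kernel s (z - (t, S t))) \<partial>lborel) \<le>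
    ennreal (C * (\<Prod>i\<in>UNIV. singular_gauss_const (\<beta> i)) / sqrt (4 * pi) ^ (CARD('n) + 1)
      * s powr (- ((1 + (\<Sum>i\<in>UNIV. \<beta> i)) / 2)))"
proof -
  let ?n = "CARD('n) + 1"
  define c where "c = C / sqrt (4 * pi * s) ^ ?n"
  have c: "c \<ge> 0" using C s by (simp add: c_def)
  define P where "P = (\<Prod>i\<in>UNIV. singular_gauss_const (\<beta> i))"
  have P: "P \<ge> 0" unfolding P_def using \<beta> by (intro prod_nonneg) (auto simp: singular_gauss_const_def less_imp_le)
  let ?g = "\<lambda>t. (\<Prod>i\<in>UNIV. \<bar>t $ i\<bar> powr (- \<beta> i)) * exp (- (1 / (4 * s)) * (norm (fst z - t))\<^sup>2)"
  have "norm (K t) * heat_kernel s (z - (t, S t)) \<le> c * ?g t" for t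
  proof -
    have "(norm (fst z - t))\<^sup>2 \<le> (norm (z - (t, S t)))\<^sup>2"
      by (cases z) (simp add: norm_Pair)
    then have "exp (- (norm (z - (t, S t)))\<^sup>2 / (4 * s)) \<le> exp (- (1 / (4 * s)) * (norm (fst z - t))\<^sup>2)"
      using s by (simp add: divide_right_mono)
    then have "heat_kernel s (z - (t, S t)) \<le> exp (- (1 / (4 * s)) * (norm (fst z - t))\<^sup>2) / sqrt (4 * pi * s) ^ ?n"
      using s unfolding heat_kernel_def by (simp add: divide_right_mono)
    then have "norm (K t) * heat_kernel s (z - (t, S t)) \<le>
      (C * (\<Prod>i\<in>UNIV. \<bar>t $ i\<bar> powr (- \<beta> i))) * (exp (- (1 / (4 * s)) * (norm (fst z - t))\<^sup>2) / sqrt (4 * pi * s) ^ ?n)"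
      using K[of t] s C by (intro mult_mono) (auto intro!: mult_nonneg_nonneg prod_nonneg)
    then show ?thesis by (simp add: c_def)
  qed
  then have "(\<integral>\<^sup>+t. ennreal (norm (K t)) * ennreal (heat_kernel s (z - (t, S t))) \<partial>lborel) \<le> (\<integral>\<^sup>+t. ennreal c * ennreal (?g t) \<partial>lborel)"
    using s c by (intro nn_integral_mono) (auto simp: ennreal_mult[symmetric] prod_nonneg simp del: ennreal_mult intro!: ennreal_leI)
  also have "\<dots> = ennreal c * (\<integral>\<^sup>+t. ennreal (?g t) \<partial>lborel)"
    by (rule nn_integral_cmult) measurable
  also have "\<dots> \<le> ennreal c * ennreal (P * s powr (\<Sum>i\<in>UNIV. (1 - \<beta> i) / 2))"
    unfolding P_def by (intro mult_left_mono nn_integral_singular_gaussian \<beta> s) simp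
  also have "\<dots> = ennreal (c * (P * s powr (\<Sum>i\<in>UNIV. (1 - \<beta> i) / 2)))"
    using c P by (simp add: ennreal_mult)
  also have "c * (P * s powr (\<Sum>i\<in>UNIV. (1 - \<beta> i) / 2)) =
    C * P / sqrt (4 * pi) ^ ?n * s powr (- ((1 + (\<Sum>i\<in>UNIV. \<beta> i)) / 2))"
  proof -
    have e: "(\<Sum>i\<in>UNIV. (1 - \<beta> i) / 2) - real ?n / 2 = - ((1 + (\<Sum>i\<in>UNIV. \<beta> i)) / 2)"
      by (simp add: sum_divide_distrib[symmetric] sum_subtractf field_simps)
    have "sqrt (4 * pi * s) ^ ?n = sqrt (4 * pi) ^ ?n * sqrt s ^ ?n"
      by (simp only: real_sqrt_mult power_mult_distrib)
    also have "sqrt s ^ ?n = s powr (real ?n / 2)"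
      using s by (subst powr_realpow[symmetric]) (simp_all add: powr_half_sqrt[symmetric] powr_powr)
    finally have "c * (P * s powr (\<Sum>i\<in>UNIV. (1 - \<beta> i) / 2)) =
      C * P / sqrt (4 * pi) ^ ?n * (s powr (\<Sum>i\<in>UNIV. (1 - \<beta> i) / 2) / s powr (real ?n / 2))"
      by (simp only: c_def times_divide_eq_left times_divide_eq_right divide_divide_eq_left mult.assoc)
    then show ?thesis by (simp only: powr_diff[symmetric] e)
  qed
  finally show ?thesis by (simp add: P_def)
qed

text \<open>
  On a bounded set the Gaussian of scale \<open>s = 1\<close> is bounded below, so integrability can be read off
  from the singular Gaussian integral centred at 0.
\<close>

lemma integrable_singular_kernel:
  fixes K :: "real ^ 'n \<Rightarrow> complex"
  assumes [measurable]: "K \<in> borel_measurable borel" and \<beta>: "\<And>i. 0 \<le> \<beta> i" "\<And>i. \<beta> i < 1" and C: "C \<ge> 0"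
    and K: "\<And>t. norm (K t) \<le> C * (\<Prod>i\<in>UNIV. \<bar>t $ i\<bar> powr (- \<beta> i))"
    and R: "\<And>t. K t \<noteq> 0 \<Longrightarrow> norm t \<le> R"
  shows "integrable lborel K"
proof (rule integrableI_bounded)
  let ?g = "\<lambda>t. (\<Prod>i\<in>UNIV. \<bar>t $ i\<bar> powr (- \<beta> i)) * exp (- (1 / (4 * 1)) * (norm (0 - t))\<^sup>2)"
  define c where "c = C * exp (R\<^sup>2 / 4)"
  have c: "c \<ge> 0" using C by (simp add: c_def)
  have le: "norm (K t) \<le> c * ?g t" for t
  proof (cases "K t = 0")
    case False
    then have "(norm t)\<^sup>2 \<le> R\<^sup>2" using R by (intro power_mono) auto
    then have "1 \<le> exp (R\<^sup>2 / 4) * exp (- (1 / (4 * 1)) * (norm (0 - t))\<^sup>2)"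
      by (simp add: exp_add[symmetric])
    then have "norm (K t) * 1 \<le> (C * (\<Prod>i\<in>UNIV. \<bar>t $ i\<bar> powr (- \<beta> i))) * (exp (R\<^sup>2 / 4) * exp (- (1 / (4 * 1)) * (norm (0 - t))\<^sup>2))"
      using K[of t] C by (intro mult_mono) (auto intro!: mult_nonneg_nonneg prod_nonneg)
    then show ?thesis by (simp add: c_def mult_ac)
  qed (use c in \<open>auto intro!: mult_nonneg_nonneg prod_nonneg\<close>)
  have "(\<integral>\<^sup>+t. ennreal (norm (K t)) \<partial>lborel) \<le> (\<integral>\<^sup>+t. ennreal c * ennreal (?g t) \<partial>lborel)"
    using le c by (intro nn_integral_mono) (auto simp: ennreal_mult'[symmetric] simp del: ennreal_mult intro!: ennreal_leI)
  also have "\<dots> = ennreal c * (\<integral>\<^sup>+t. ennreal (?g t) \<partial>lborel)"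
    by (rule nn_integral_cmult) measurable
  also have "\<dots> \<le> ennreal c * ennreal ((\<Prod>i\<in>UNIV. singular_gauss_const (\<beta> i)) * 1 powr (\<Sum>i\<in>UNIV. (1 - \<beta> i) / 2))"
    by (intro mult_left_mono nn_integral_singular_gaussian \<beta>) simp_all
  also have "\<dots> < \<infinity>" by (simp add: ennreal_mult_less_top)
  finally show "(\<integral>\<^sup>+t. ennreal (norm (K t)) \<partial>lborel) < \<infinity>" .
qed simp

lemma bounded_Lp_sobolev_cong:
  assumes "\<And>f. schwartz f \<Longrightarrow> T f = T' f"
  shows "bounded_Lp_sobolev T p q s \<longleftrightarrow> bounded_Lp_sobolev T' p q s"
  unfolding bounded_Lp_sobolev_def using assms by (intro ex_cong1 conj_cong refl all_cong) simp

theorem theorem1p2: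
  fixes U :: "(real ^ 'n) set"
    and S :: "real ^ 'n \<Rightarrow> real"
    and K :: "real ^ 'n \<Rightarrow> complex"
    and m :: nat
    and grp :: "'n \<Rightarrow> nat"
    and \<alpha> :: "nat \<Rightarrow> real"
    and C p q \<gamma> :: real
  assumes "open U" and "0 \<in> U"
    and "real_analytic_on S U"
    and "\<exists>t\<in>U. S t \<noteq> 0"
    and "S 0 = 0" and "GDERIV S 0 :> 0"
    and "range grp = {1..m}"
    and "\<And>k. k \<in> {1..m} \<Longrightarrow> 0 \<le> \<alpha> k \<and> \<alpha> k < real (card {j. grp j = k})"
    and "compact (closure {t. K t \<noteq> 0})" and "closure {t. K t \<noteq> 0} \<subseteq> U"
    and "C1_on {t \<in> U. \<forall>i. t $ i \<noteq> 0} K"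
    and "C > 0"
    and "\<And>t. t \<in> U \<Longrightarrow> (\<And>i. t $ i \<noteq> 0) \<Longrightarrow>
           norm (K t) \<le> C * (\<Prod>k=1..m. group_norm grp k t powr (- \<alpha> k))"
    and "\<And>t j. t \<in> U \<Longrightarrow> (\<And>i. t $ i \<noteq> 0) \<Longrightarrow>
           norm (partial_deriv (axis j 1) K t)
             \<le> C * (1 / \<bar>t $ j\<bar>) * (\<Prod>k=1..m. group_norm grp k t powr (- \<alpha> k))"
    and "1 < p" and "p < q"
    and "\<gamma> > 1 + (\<Sum>k=1..m. \<alpha> k)"
  shows "bounded_Lp_sobolev (surface_conv S K) p q (- \<gamma>)"
proof -
  note U = assms(1) and S = assms(3) and grp = assms(7) and \<alpha> = assms(8) and supp = assms(9,10)
    and K_C1 = assms(11) and C = assms(12) and K_bound = assms(13) and p = assms(15,16) and \<gamma> = assms(17)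
  define V where "V = U \<inter> {t. \<forall>i. t $ i \<noteq> 0}"
  \<comment> \<open>Borel functions that agree almost everywhere with \<open>K\<close> and, where \<open>K \<noteq> 0\<close>, with \<open>S\<close>\<close>
  define K' where "K' t = indicator V t *\<^sub>R K t" for t
  define S' where "S' t = indicator U t *\<^sub>R S t" for t
  define \<beta> where "\<beta> i = \<alpha> (grp i) / real (card {j. grp j = grp i})" for i
  have grp_in: "grp i \<in> {1..m}" for i using grp by auto
  have card_pos: "card {j. grp j = grp i} > 0" for i by (auto simp: card_gt_0_iff)
  have \<beta>: "0 \<le> \<beta> i" "\<beta> i < 1" for i
    using \<alpha>[OF grp_in[of i]] card_pos[of i] by (auto simp: \<beta>_def)
  have grp_ne: "\<exists>j. grp j = k" if "k \<in> {1..m}" for k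
    using that unfolding grp[symmetric] by auto
  have \<beta>_sum: "(\<Sum>i\<in>UNIV. \<beta> i) = (\<Sum>k=1..m. \<alpha> k)"
    unfolding \<beta>_def using grp by (intro sum_group_average) auto
  have "open V" unfolding V_def by (intro open_Int U open_nonzero_coords)
  have V_eq: "V = {t \<in> U. \<forall>i. t $ i \<noteq> 0}" by (auto simp: V_def)
  have "continuous_on V K"
    using K_C1 unfolding C1_on_def V_eq
    by (auto intro!: continuous_at_imp_continuous_on differentiable_imp_continuous_within)
  then have K'_meas [measurable]: "K' \<in> borel_measurable borel"
    unfolding K'_def using \<open>open V\<close> by (intro borel_measurable_continuous_on_indicator) auto
  have S'_meas [measurable]: "S' \<in> borel_measurable borel"
    unfolding S'_def using U real_analytic_on_imp_continuous_on[OF S]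
    by (intro borel_measurable_continuous_on_indicator) auto
  have K'_bound: "norm (K' t) \<le> C * (\<Prod>i\<in>UNIV. \<bar>t $ i\<bar> powr (- \<beta> i))" for t
  proof (cases "t \<in> V")
    case True
    then have t: "t \<in> U" "\<And>i. t $ i \<noteq> 0" by (auto simp: V_def)
    have "norm (K t) \<le> C * (\<Prod>k=1..m. group_norm grp k t powr (- \<alpha> k))" by (rule K_bound[OF t])
    also have "\<dots> \<le> C * (\<Prod>i\<in>UNIV. \<bar>t $ i\<bar> powr (- \<beta> i))"
      unfolding \<beta>_def using C \<alpha> t grp grp_ne by (intro mult_left_mono prod_group_norm_powr_le) auto
    finally show ?thesis using True by (simp add: K'_def)
  qed (use C in \<open>auto simp: K'_def intro!: mult_nonneg_nonneg prod_nonneg\<close>)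
  obtain R where R: "\<And>t. t \<in> closure {t. K t \<noteq> 0} \<Longrightarrow> norm t \<le> R"
    using compact_imp_bounded[OF supp(1)] unfolding bounded_iff by blast
  have K'_int: "integrable lborel K'"
  proof (rule integrable_singular_kernel[OF K'_meas \<beta> _ K'_bound])
    fix t assume "K' t \<noteq> 0"
    then have "t \<in> closure {t. K t \<noteq> 0}"
      by (intro subsetD[OF closure_subset]) (auto simp: K'_def)
    then show "norm t \<le> R" by (rule R)
  qed (use C in simp)
  have K_eq: "AE t in lborel. K t = K' t \<and> (K t \<noteq> 0 \<longrightarrow> S t = S' t)"
    using AE_lborel_nth_nonzero
  proof eventually_elim
    case (elim t)
    have "K t \<noteq> 0 \<Longrightarrow> t \<in> U" using supp(2) closure_subset[of "{t. K t \<noteq> 0}"] by blast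
    then show ?case using elim by (auto simp: K'_def S'_def V_def indicator_def)
  qed
  define A where "A = C * (\<Prod>i\<in>UNIV. singular_gauss_const (\<beta> i)) / sqrt (4 * pi) ^ (CARD('n) + 1)"
  have A: "A \<ge> 0"
    unfolding A_def using C \<beta> by (intro divide_nonneg_pos mult_nonneg_nonneg prod_nonneg)
      (auto simp: singular_gauss_const_def less_imp_le)
  have "bounded_Lp_sobolev (\<lambda>f x. LINT t|lborel. f (x - (t, S' t)) * K' t) p q (- \<gamma>)"
  proof (rule bounded_Lp_sobolev_of_heat_bound[where \<delta>="1 + (\<Sum>i\<in>UNIV. \<beta> i)" and A=A])
    show "sigma_finite_measure (lborel :: (real ^ 'n) measure)" ..
    show "(\<integral>\<^sup>+t. ennreal (norm (K' t)) * ennreal (heat_kernel s (z - (t, S' t))) \<partial>lborel)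
      \<le> ennreal (A * s powr (- ((1 + (\<Sum>i\<in>UNIV. \<beta> i)) / 2)))" if "s > 0" for s z
      unfolding A_def using C by (intro nn_integral_singular_kernel_heat_le \<beta> K'_bound that) simp
    have "0 \<le> (\<Sum>i\<in>UNIV. \<beta> i)" using \<beta> by (intro sum_nonneg) auto
    then show "0 < \<gamma>" "1 + (\<Sum>i\<in>UNIV. \<beta> i) < \<gamma>" using \<gamma> \<beta>_sum by auto
  qed (use K'_int A p in auto)
  also have "?this \<longleftrightarrow> ?thesis"
  proof (rule bounded_Lp_sobolev_cong)
    fix f :: "(real ^ 'n) \<times> real \<Rightarrow> complex" assume "schwartz f"
    note [measurable] = schwartz_measurable[OF this]
    show "(\<lambda>x. LINT t|lborel. f (x - (t, S' t)) * K' t) = surface_conv S K f"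
    proof
      fix x :: "(real ^ 'n) \<times> real"
      have "(LINT t|lebesgue. f (fst x - t, snd x - S t) * K t) = (LINT t|lborel. f (x - (t, S' t)) * K' t)"
      proof (rule integral_lebesgue_cong_AE_borel)
        show "AE t in lborel. f (fst x - t, snd x - S t) * K t = f (x - (t, S' t)) * K' t"
          using K_eq by eventually_elim (cases x, auto)
      qed measurable
      then show "(LINT t|lborel. f (x - (t, S' t)) * K' t) = surface_conv S K f x"
        by (simp add: surface_conv_def case_prod_beta)
    qed
  qed
  finally show ?thesis .
qed

end
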